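(* Let $G$ be a graph on $n\ge 3$ vertices and let $v$ be a cut vertex of $G$. Write $G$ as the vertex sum at $v$ of graphs $G_1,G_2,\ldots,G_k$, $k\ge 2$. Then $$\mathcal{I}(G) = \bigl[\mathcal{I}(G_1)+\mathcal{I}(G_2)+\cdots+\mathcal{I}(G_k)\bigr]_n \cup \bigl[\mathcal{I}(G_1-v)+\mathcal{I}(G_2-v)+\cdots+\mathcal{I}(G_k-v)+\{(1,1)\}\bigr]_n,$$ and similarly for the Hermitian inertia sets: $$\mathrm{h}\mathcal{I}(G) = \bigl[\mathrm{h}\mathcal{I}(G_1)+\cdots+\mathrm{h}\mathcal{I}(G_k)\bigr]_n \cup \bigl[\mathrm{h}\mathcal{I}(G_1-v)+\cdots+\mathrm{h}\mathcal{I}(G_k-v)+\{(1,1)\}\bigr]_n.$$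
   Context: All graphs are finite, simple and undirected. For a graph $G=(V,E)$ on $n$ vertices, $\mathcal{S}(G)$ (respectively $\mathcal{H}(G)$) is the set of all real symmetric (respectively complex Hermitian) $n\times n$ matrices $A=[a_{ij}]$, with rows and columns indexed by $V$, such that for $i\neq j$, $a_{ij}\neq 0$ if and only if $ij\in E$ (no condition on the diagonal entries). The partial inertia of a Hermitian matrix $A$ is $\operatorname{pin}(A)=(\pi(A),\nu(A))$, where $\pi(A)$ and $\nu(A)$ are the numbers of positive and of negative eigenvalues of $A$, counted with multiplicity. Define the inertia set $\mathcal{I}(G)=\{\operatorname{pin}(A): A\in\mathcal{S}(G)\}$ and the Hermitian inertia set $\mathrm{h}\mathcal{I}(G)=\{\operatorname{pin}(A): A\in\mathcal{H}(G)\}$. $\mathbb{N}$ denotes the nonnegative integers. For $Q,R\subseteq\mathbb{N}^2$, $Q+R=\{(a+c,b+d):(a,b)\in Q,\ (c,d)\in R\}$, and similarly for three or more sets; $[Q]_n=\{(r,s)\in Q: r+s\le n\}$. If $G_1,\ldots,G_k$ ($k\ge 2$) are graphs, each on at least two vertices, each with a vertex labeled $v$ (and otherwise disjoint), their vertex sum at $v$ is the graph on $\sum_{i=1}^k|G_i|-(k-1)$ vertices obtained by identifying the vertex $v$ in all of the $G_i$. $G-v$ denotes the graph obtained from $G$ by deleting the vertex $v$. *)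

theory Defs
  imports
    "Graph_Theory.Digraph_Component"
    "Jordan_Normal_Form.Char_Poly"
    "Jordan_Normal_Form.Schur_Decomposition"
    "HOL-Library.Product_Plus"
    "HOL-Library.Set_Algebras"
begin

text \<open>
  A finite simple undirected graph is a pre-digraph \<open>G\<close> satisfying the locale predicate
  \<^const>\<open>graph\<close>: finite, without loops and parallel arcs, and with a symmetric adjacency relation
  \<open>u \<rightarrow>\<^bsub>G\<^esub> w\<close>. Each edge is represented by its two arcs. For such \<open>G\<close> the strongly connected
  components are the connected components in the usual sense.

  Sums of subsets of \<open>nat \<times> nat\<close> are the elementwise sums of Set_Algebras, where
  \<open>nat \<times> nat\<close> carries the componentwise addition of Product_Plus.
\<close>

definition cut_vertex :: "('v, 'e) pre_digraph \<Rightarrow> 'v \<Rightarrow> bool" where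
  "cut_vertex G v \<longleftrightarrow> v \<in> verts G \<and>
     card (pre_digraph.sccs G) < card (pre_digraph.sccs (pre_digraph.del_vert G v))"

text \<open>
  \<open>G\<close> is the vertex sum at \<open>v\<close> of \<open>H 1, \<dots>, H k\<close>. The identification of the copies of \<open>v\<close> is
  carried out literally: the summands share the vertex \<open>v\<close> and nothing else. Since they are loop-free,
  their arc sets are then disjoint as well.
\<close>

definition vertex_sum ::
  "('v, 'e) pre_digraph \<Rightarrow> 'v \<Rightarrow> nat \<Rightarrow> (nat \<Rightarrow> ('v, 'e) pre_digraph) \<Rightarrow> bool" where
  "vertex_sum G v k H \<longleftrightarrow>
     2 \<le> k \<and>
     (\<forall>i\<in>{1..k}. graph (H i) \<and> compatible G (H i) \<and> 2 \<le> card (verts (H i)) \<and> v \<in> verts (H i)) \<and>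
     (\<forall>i\<in>{1..k}. \<forall>j\<in>{1..k}. i \<noteq> j \<longrightarrow> verts (H i) \<inter> verts (H j) = {v}) \<and>
     verts G = (\<Union>i\<in>{1..k}. verts (H i)) \<and>
     arcs G = (\<Union>i\<in>{1..k}. arcs (H i))"

text \<open>
  Indexing rows and columns by the vertices means choosing a bijection \<open>f\<close> from the index range
  to the vertex set; \<open>f i\<close> is the vertex belonging to row and column \<open>i\<close>. Different choices
  of \<open>f\<close> permute rows and columns simultaneously, which does not change eigenvalues.
\<close>

definition has_pattern :: "('v, 'e) pre_digraph \<Rightarrow> 'a :: zero mat \<Rightarrow> bool" where
  "has_pattern G A \<longleftrightarrow>
     A \<in> carrier_mat (card (verts G)) (card (verts G)) \<and>
     (\<exists>f. bij_betw f {..<card (verts G)} (verts G) \<and>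
        (\<forall>i < card (verts G). \<forall>j < card (verts G). i \<noteq> j \<longrightarrow>
           (A $$ (i, j) \<noteq> 0 \<longleftrightarrow> f i \<rightarrow>\<^bsub>G\<^esub> f j)))"

definition symmetric_mats :: "('v, 'e) pre_digraph \<Rightarrow> real mat set" where
  "symmetric_mats G = {A. has_pattern G A \<and> transpose_mat A = A}"

definition hermitian_mats :: "('v, 'e) pre_digraph \<Rightarrow> complex mat set" where
  "hermitian_mats G = {A. has_pattern G A \<and> mat_adjoint A = A}"

text \<open>
  Positive and negative eigenvalues are real by definition, so the sums range over real \<open>x\<close>,
  for real as well as for complex matrices.
\<close>

definition num_pos_eigenvalues :: "'a :: real_field mat \<Rightarrow> nat" where
  "num_pos_eigenvalues A =
     (\<Sum>x | 0 < x \<and> eigenvalue A (of_real x). Polynomial.order (of_real x) (char_poly A))"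

definition num_neg_eigenvalues :: "'a :: real_field mat \<Rightarrow> nat" where
  "num_neg_eigenvalues A =
     (\<Sum>x | x < 0 \<and> eigenvalue A (of_real x). Polynomial.order (of_real x) (char_poly A))"

definition pin :: "'a :: real_field mat \<Rightarrow> nat \<times> nat" where
  "pin A = (num_pos_eigenvalues A, num_neg_eigenvalues A)"

definition inertia_set :: "('v, 'e) pre_digraph \<Rightarrow> (nat \<times> nat) set" where
  "inertia_set G = pin ` symmetric_mats G"

definition hermitian_inertia_set :: "('v, 'e) pre_digraph \<Rightarrow> (nat \<times> nat) set" where
  "hermitian_inertia_set G = pin ` hermitian_mats G"

definition truncate_at :: "nat \<Rightarrow> (nat \<times> nat) set \<Rightarrow> (nat \<times> nat) set" where
  "truncate_at n Q = {(r, s). (r, s) \<in> Q \<and> r + s \<le> n}"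

end

theory Submission
  imports Defs
begin

text \<open>
  Only the Hermitian form matters, not the matrix: rows and columns are indexed by the vertices
  themselves, a form on a finite set \<open>V\<close> is a function \<open>A\<close> of two vertices, and its inertia is read
  off from any diagonalization \<open>A = (\<Sum>j. d\<^sub>j z\<^sub>j z\<^sub>j\<^sup>*)\<close> with linearly independent \<open>z\<^sub>j\<close>, by counting the
  signs of the \<open>d\<^sub>j\<close>. Sylvester's law of inertia (\<open>sylvester_inertia\<close>) makes this well defined, and
  it says more: a decomposition of \<open>A\<close> with possibly dependent \<open>z\<^sub>j\<close> still bounds the inertia from
  above. Hence inertia is subadditive (\<open>inertia_subadditive\<close>). The spectral theorem identifies the
  inertia with the eigenvalue counts of the matrix (\<open>has_inertia_pin\<close>).

  Let \<open>v\<close> be the common vertex, \<open>W\<^sub>i\<close> the other vertices of the \<open>i\<close>-th summand and \<open>W\<close> the union of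
  the \<open>W\<^sub>i\<close>. No edge joins different \<open>W\<^sub>i\<close>, so a form with the pattern of the vertex sum is on \<open>W\<close> a
  direct sum of its restrictions to the \<open>W\<^sub>i\<close>, and inertias add. Everything then depends on what
  bordering by \<open>v\<close> does. If the column of \<open>v\<close> lies in the range of the form on \<open>W\<close>, the inertia
  grows by the sign of the Schur complement (\<open>border_inertia_in_range\<close>); otherwise it grows by
  exactly \<open>(1, 1)\<close> (\<open>border_inertia_out_of_range\<close>).

  For the inclusion from left to right: the column of \<open>v\<close> is in the range on \<open>W\<close> iff this holds on every
  \<open>W\<^sub>i\<close>. If it does, the diagonal entry at \<open>v\<close> can be split among the summands so that one of them
  receives the whole Schur complement and all others the Schur complement \<open>0\<close>; the inertias of the
  summands then add up to that of the whole. If it does not, the second set is reached directly.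

  For the converse, overlay forms on the summands, or put forms on the \<open>W\<^sub>i\<close> side by side and border
  them arbitrarily. By subadditivity, respectively by the two bordering lemmas, the result has
  inertia at most the requested pair, which in turn has sum at most \<open>n\<close>. Such a gap can always be
  closed: a singular form becomes one with one more positive or one more negative direction when a
  suitable diagonal entry is changed, and diagonal entries are not constrained by the graph
  (\<open>form_inertia_northeast\<close>).

  All constructions change or choose only real entries, so real symmetric and complex Hermitian
  matrices are treated at once, as forms with entries in \<open>K = \<real>\<close> or \<open>K = UNIV\<close>.
\<close>

section \<open>Homogeneous linear systems\<close>

text \<open>
  Gaussian elimination, one equation at a time: if some unknown \<open>b\<close> occurs in the equation \<open>a\<close>,
  subtract multiples of that equation from the others, solve them without \<open>b\<close>, and let the equation
  \<open>a\<close> determine \<open>b\<close>.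
\<close>

lemma homogeneous_system_nontrivial_solution:
  fixes M :: "'i \<Rightarrow> 'j \<Rightarrow> 'a :: field"
  assumes "finite I" "finite J" "card I < card J"
  shows "\<exists>c. (\<exists>j\<in>J. c j \<noteq> 0) \<and> (\<forall>i\<in>I. (\<Sum>j\<in>J. c j * M i j) = 0)"
  using assms
proof (induction I arbitrary: J M rule: finite_induct)
  case empty
  then have "J \<noteq> {}" by auto
  then show ?case by (intro exI[of _ "\<lambda>_. 1"]) auto
next
  case (insert a I)
  show ?case
  proof (cases "\<forall>j\<in>J. M a j = 0")
    case True
    have "card I < card J" using insert by simp
    from insert.IH[OF insert.prems(1) this, of M] show ?thesis using True by simp
  next
    case False
    then obtain b where b: "b \<in> J" "M a b \<noteq> 0" by auto
    have "card I < card (J - {b})" using insert b by (simp add: card_Diff_singleton)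
    from insert.IH[OF _ this, of "\<lambda>i j. M i j - M i b * M a j / M a b"] insert.prems(1)
    obtain c where c: "\<exists>j\<in>J-{b}. c j \<noteq> 0"
      "\<And>i. i \<in> I \<Longrightarrow> (\<Sum>j\<in>J-{b}. c j * (M i j - M i b * M a j / M a b)) = 0" by blast
    define s where "s = - (\<Sum>j\<in>J-{b}. c j * M a j) / M a b"
    define c' where "c' = c(b := s)"
    have sum: "(\<Sum>j\<in>J. c' j * M i j) = s * M i b + (\<Sum>j\<in>J-{b}. c j * M i j)" for i
    proof -
      have "(\<Sum>j\<in>J-{b}. c' j * M i j) = (\<Sum>j\<in>J-{b}. c j * M i j)"
        by (intro sum.cong refl) (auto simp: c'_def)
      then show ?thesis
        using sum.remove[OF insert.prems(1) b(1), of "\<lambda>j. c' j * M i j"] by (simp add: c'_def)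
    qed
    have "(\<Sum>j\<in>J. c' j * M i j) = 0" if "i \<in> insert a I" for i
    proof (cases "i = a")
      case True
      then show ?thesis using b by (simp add: sum[of a] s_def)
    next
      case False
      then have "i \<in> I" using that by simp
      have "(\<Sum>j\<in>J-{b}. c j * (M i j - M i b * M a j / M a b)) =
          (\<Sum>j\<in>J-{b}. c j * M i j) - (\<Sum>j\<in>J-{b}. c j * M a j) * (M i b / M a b)"
        unfolding sum_distrib_right sum_subtractf[symmetric]
        by (intro sum.cong refl) (simp add: right_diff_distrib)
      with c(2)[OF \<open>i \<in> I\<close>] have "(\<Sum>j\<in>J-{b}. c j * M i j) = (\<Sum>j\<in>J-{b}. c j * M a j) * (M i b / M a b)"
        by simp
      then show ?thesis by (simp add: sum[of i] s_def)
    qed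
    moreover have "\<exists>j\<in>J. c' j \<noteq> 0" using c(1) by (auto simp: c'_def)
    ultimately show ?thesis by blast
  qed
qed

section \<open>Diagonalizations of Hermitian forms\<close>

definition hermitian_on :: "'v set \<Rightarrow> ('v \<Rightarrow> 'v \<Rightarrow> complex) \<Rightarrow> bool" where
  "hermitian_on V A \<longleftrightarrow> (\<forall>x\<in>V. \<forall>y\<in>V. A y x = cnj (A x y))"

lemma hermitian_onD: "hermitian_on V A \<Longrightarrow> x \<in> V \<Longrightarrow> y \<in> V \<Longrightarrow> A y x = cnj (A x y)"
  unfolding hermitian_on_def by blast

lemma hermitian_on_subset: "hermitian_on V A \<Longrightarrow> W \<subseteq> V \<Longrightarrow> hermitian_on W A"
  unfolding hermitian_on_def by blast

lemma hermitian_on_diagonal_real: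
  assumes "hermitian_on V A" "x \<in> V"
  shows "complex_of_real (Re (A x x)) = A x x"
proof -
  have "A x x = cnj (A x x)" using assms hermitian_onD by metis
  then show ?thesis by (metis Reals_cnj_iff of_real_Re)
qed

text \<open>
  Linear independence of the \<open>z\<^sub>j\<close> is expressed by a witness, a dual family \<open>u\<close> of functionals. Explicit
  duals make it possible to project along the \<open>z\<^sub>j\<close> by a formula, without talking about spans and
  bases. Zero coefficients \<open>d\<^sub>j\<close> are admitted, so that a Schur complement may vanish.
\<close>

definition diagonalizes ::
  "'v set \<Rightarrow> ('v \<Rightarrow> 'v \<Rightarrow> complex) \<Rightarrow> 'i set \<Rightarrow> ('i \<Rightarrow> real) \<Rightarrow> ('i \<Rightarrow> 'v \<Rightarrow> complex) \<Rightarrow>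
   ('i \<Rightarrow> 'v \<Rightarrow> complex) \<Rightarrow> bool" where
  "diagonalizes V A J d z u \<longleftrightarrow> finite J \<and>
     (\<forall>x\<in>V. \<forall>y\<in>V. A x y = (\<Sum>j\<in>J. of_real (d j) * z j x * cnj (z j y))) \<and>
     (\<forall>i\<in>J. \<forall>j\<in>J. (\<Sum>x\<in>V. u i x * z j x) = of_bool (i = j))"

lemma diagonalizesD:
  assumes "diagonalizes V A J d z u"
  shows "finite J"
    "\<And>x y. x \<in> V \<Longrightarrow> y \<in> V \<Longrightarrow> A x y = (\<Sum>j\<in>J. of_real (d j) * z j x * cnj (z j y))"
    "\<And>i j. i \<in> J \<Longrightarrow> j \<in> J \<Longrightarrow> (\<Sum>x\<in>V. u i x * z j x) = of_bool (i = j)"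
  using assms unfolding diagonalizes_def by blast+

definition sign_pair :: "real \<Rightarrow> nat \<times> nat" where
  "sign_pair t = (of_bool (t > 0), of_bool (t < 0))"

lemma sign_pair_simps [simp]:
  "sign_pair 0 = 0" "t > 0 \<Longrightarrow> sign_pair t = (1, 0)" "t < 0 \<Longrightarrow> sign_pair t = (0, 1)"
  by (auto simp: sign_pair_def zero_prod_def)

text \<open>
  Since \<open>J\<close> is finite, fixing the index type to \<open>nat\<close> loses nothing: the lemma \<open>has_inertiaI\<close> below
  accepts diagonalizations over any index type.
\<close>

definition has_inertia :: "'v set \<Rightarrow> ('v \<Rightarrow> 'v \<Rightarrow> complex) \<Rightarrow> nat \<times> nat \<Rightarrow> bool" where
  "has_inertia V A p \<longleftrightarrow>
     (\<exists>(J :: nat set) d z u. diagonalizes V A J d z u \<and> p = (\<Sum>j\<in>J. sign_pair (d j)))"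

lemma fst_sum_sign_pair: "finite J \<Longrightarrow> fst (\<Sum>j\<in>J. sign_pair (d j)) = card {j\<in>J. d j > 0}"
  by (simp add: fst_sum sign_pair_def sum_of_bool_eq Int_def)

lemma snd_sum_sign_pair: "finite J \<Longrightarrow> snd (\<Sum>j\<in>J. sign_pair (d j)) = card {j\<in>J. d j < 0}"
  by (simp add: snd_sum sign_pair_def sum_of_bool_eq Int_def)

lemma diagonalizes_reindex:
  assumes "diagonalizes V A J d z u" "bij_betw g K J"
  shows "diagonalizes V A K (d \<circ> g) (z \<circ> g) (u \<circ> g)"
  unfolding diagonalizes_def
proof (intro conjI ballI)
  show "finite K" using assms by (simp add: diagonalizes_def bij_betw_finite)
  show "A x y = (\<Sum>j\<in>K. of_real ((d \<circ> g) j) * (z \<circ> g) j x * cnj ((z \<circ> g) j y))"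
    if "x \<in> V" "y \<in> V" for x y
    using diagonalizesD(2)[OF assms(1) that]
      sum.reindex_bij_betw[OF assms(2), of "\<lambda>j. of_real (d j) * z j x * cnj (z j y)"] by simp
  show "(\<Sum>x\<in>V. (u \<circ> g) i x * (z \<circ> g) j x) = of_bool (i = j)" if "i \<in> K" "j \<in> K" for i j
    using diagonalizesD(3)[OF assms(1), of "g i" "g j"] that assms(2)
    by (auto simp: bij_betw_def inj_on_def)
qed

lemma has_inertiaI:
  assumes "diagonalizes V A J d z u" "p = (\<Sum>j\<in>J. sign_pair (d j))"
  shows "has_inertia V A p"
proof -
  obtain g where g: "bij_betw g {0..<card J} J"
    using ex_bij_betw_nat_finite diagonalizesD(1)[OF assms(1)] by blast
  have "p = (\<Sum>j\<in>{0..<card J}. sign_pair ((d \<circ> g) j))"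
    using sum.reindex_bij_betw[OF g, of "\<lambda>j. sign_pair (d j)"] assms(2) by simp
  then show ?thesis
    unfolding has_inertia_def using diagonalizes_reindex[OF assms(1) g] by blast
qed

lemma diagonalizes_restrict:
  assumes "diagonalizes V A J d z u"
  shows "diagonalizes V A {j\<in>J. d j \<noteq> 0} d z u"
  unfolding diagonalizes_def
proof (intro conjI ballI)
  note D = diagonalizesD[OF assms]
  show "finite {j\<in>J. d j \<noteq> 0}" using D(1) by simp
  show "A x y = (\<Sum>j\<in>{j\<in>J. d j \<noteq> 0}. of_real (d j) * z j x * cnj (z j y))"
    if "x \<in> V" "y \<in> V" for x y
    using D(2)[OF that] D(1) by (auto simp: intro!: sum.mono_neutral_right)
  show "(\<Sum>x\<in>V. u i x * z j x) = of_bool (i = j)"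
    if "i \<in> {j\<in>J. d j \<noteq> 0}" "j \<in> {j\<in>J. d j \<noteq> 0}" for i j
    using D(3) that by auto
qed

lemma has_inertiaE:
  assumes "has_inertia V A p"
  obtains J :: "nat set" and d z u where "diagonalizes V A J d z u" "\<forall>j\<in>J. d j \<noteq> 0"
    "p = (\<Sum>j\<in>J. sign_pair (d j))"
proof -
  obtain J :: "nat set" and d z u where D: "diagonalizes V A J d z u"
    and p: "p = (\<Sum>j\<in>J. sign_pair (d j))"
    using assms by (auto simp: has_inertia_def)
  have "p = (\<Sum>j\<in>{j\<in>J. d j \<noteq> 0}. sign_pair (d j))"
    unfolding p using diagonalizesD(1)[OF D] by (intro sum.mono_neutral_right) auto
  then show thesis using that diagonalizes_restrict[OF D] by blast
qed

lemma has_inertia_cong: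
  assumes "has_inertia V A p" "\<And>x y. x \<in> V \<Longrightarrow> y \<in> V \<Longrightarrow> A x y = B x y"
  shows "has_inertia V B p"
proof -
  have "diagonalizes V A J d z u \<longleftrightarrow> diagonalizes V B J d z u" for J :: "nat set" and d z u
    using assms(2) by (auto simp: diagonalizes_def)
  then show ?thesis using assms(1) unfolding has_inertia_def by simp
qed

section \<open>Sylvester's law of inertia\<close>

lemma quadratic_form_decomposition:
  assumes "\<And>x y. x \<in> V \<Longrightarrow> y \<in> V \<Longrightarrow> A x y = (\<Sum>k\<in>K. of_real (b k) * g k x * cnj (g k y))"
  shows "(\<Sum>x\<in>V. \<Sum>y\<in>V. h x * A x y * cnj (h y)) =
    complex_of_real (\<Sum>k\<in>K. b k * (cmod (\<Sum>x\<in>V. h x * g k x))\<^sup>2)"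
proof -
  have "(\<Sum>x\<in>V. \<Sum>y\<in>V. h x * A x y * cnj (h y)) =
      (\<Sum>x\<in>V. \<Sum>y\<in>V. \<Sum>k\<in>K. of_real (b k) * ((h x * g k x) * cnj (h y * g k y)))"
    by (intro sum.cong refl) (simp add: assms sum_distrib_left sum_distrib_right mult_ac)
  also have "\<dots> = (\<Sum>x\<in>V. \<Sum>k\<in>K. \<Sum>y\<in>V. of_real (b k) * ((h x * g k x) * cnj (h y * g k y)))"
    by (intro sum.cong refl sum.swap)
  also have "\<dots> = (\<Sum>k\<in>K. \<Sum>x\<in>V. \<Sum>y\<in>V. of_real (b k) * ((h x * g k x) * cnj (h y * g k y)))"
    by (rule sum.swap)
  also have "\<dots> = (\<Sum>k\<in>K. of_real (b k) * ((\<Sum>x\<in>V. h x * g k x) * cnj (\<Sum>x\<in>V. h x * g k x)))"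
    unfolding cnj_sum sum_product by (simp add: sum_distrib_left)
  finally show ?thesis by (simp only: of_real_sum of_real_mult complex_norm_square)
qed

text \<open>
  The functionals dual to the \<open>z\<^sub>j\<close> with \<open>d\<^sub>j > 0\<close> span a space on which \<open>A\<close> is positive definite. If there
  were fewer positive \<open>e\<^sub>l\<close> than positive \<open>d\<^sub>j\<close>, this space would contain a nonzero \<open>h\<close> that annihilates
  every \<open>w\<^sub>l\<close> with \<open>e\<^sub>l > 0\<close>, and the second decomposition would give a nonpositive value at \<open>h\<close>. The
  \<open>w\<^sub>l\<close> may be dependent, which is what makes subadditivity a corollary.
\<close>

lemma sylvester_positive:
  assumes D: "diagonalizes V A J d z u" and finL: "finite L"
    and L: "\<And>x y. x \<in> V \<Longrightarrow> y \<in> V \<Longrightarrow> A x y = (\<Sum>l\<in>L. of_real (e l) * w l x * cnj (w l y))"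
  shows "card {j\<in>J. d j > 0} \<le> card {l\<in>L. e l > 0}"
proof (rule ccontr)
  note D = diagonalizesD[OF D]
  let ?P = "{j\<in>J. d j > 0}"
  assume "\<not> ?thesis"
  then have "card {l\<in>L. e l > 0} < card ?P" by simp
  from homogeneous_system_nontrivial_solution[OF _ _ this, of "\<lambda>l j. \<Sum>x\<in>V. u j x * w l x"]
  obtain c where c: "\<exists>j\<in>?P. c j \<noteq> 0"
    "\<And>l. l \<in> L \<Longrightarrow> e l > 0 \<Longrightarrow> (\<Sum>j\<in>?P. c j * (\<Sum>x\<in>V. u j x * w l x)) = 0"
    using finL D(1) by auto
  define h where "h x = (\<Sum>j\<in>?P. c j * u j x)" for x
  have h: "(\<Sum>x\<in>V. h x * f x) = (\<Sum>j\<in>?P. c j * (\<Sum>x\<in>V. u j x * f x))" for f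
    unfolding h_def sum_distrib_right sum_distrib_left by (subst sum.swap) (simp add: mult.assoc)
  have hz: "(\<Sum>x\<in>V. h x * z k x) = (if k \<in> ?P then c k else 0)" if "k \<in> J" for k
  proof -
    have "(\<Sum>x\<in>V. h x * z k x) = (\<Sum>j\<in>?P. c j * of_bool (j = k))"
      unfolding h using D(3) that by (intro sum.cong) auto
    then show ?thesis using D(1) by (simp add: if_distrib[of "(*) _"] sum.delta of_bool_def cong: if_cong)
  qed
  have "(\<Sum>k\<in>J. d k * (cmod (\<Sum>x\<in>V. h x * z k x))\<^sup>2) = (\<Sum>k\<in>?P. d k * (cmod (c k))\<^sup>2)"
    using D(1) by (intro sum.mono_neutral_cong_right) (auto simp: hz)
  moreover have "\<dots> > 0"
  proof -
    obtain j where j: "j \<in> ?P" "c j \<noteq> 0" using c(1) by blast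
    show ?thesis using D(1) j by (intro sum_pos2[of _ j]) auto
  qed
  moreover have "(\<Sum>l\<in>L. e l * (cmod (\<Sum>x\<in>V. h x * w l x))\<^sup>2) \<le> 0"
  proof (rule sum_nonpos)
    fix l assume l: "l \<in> L"
    show "e l * (cmod (\<Sum>x\<in>V. h x * w l x))\<^sup>2 \<le> 0"
    proof (cases "e l > 0")
      case True
      then have "(\<Sum>x\<in>V. h x * w l x) = 0" unfolding h using c(2)[OF l] by blast
      then show ?thesis by simp
    qed (simp add: mult_nonpos_nonneg)
  qed
  moreover have "(\<Sum>k\<in>J. d k * (cmod (\<Sum>x\<in>V. h x * z k x))\<^sup>2) =
      (\<Sum>l\<in>L. e l * (cmod (\<Sum>x\<in>V. h x * w l x))\<^sup>2)"
  proof -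
    note E1 = quadratic_form_decomposition[where V = V and A = A and K = J and b = d and g = z and h = h, OF D(2)]
    note E2 = quadratic_form_decomposition[where V = V and A = A and K = L and b = e and g = w and h = h, OF L]
    show ?thesis using trans[OF E1[symmetric] E2] by (simp only: of_real_eq_iff)
  qed
  ultimately show False by linarith
qed

lemma sylvester_inertia:
  assumes D: "has_inertia V A p" and finL: "finite L"
    and L: "\<And>x y. x \<in> V \<Longrightarrow> y \<in> V \<Longrightarrow> A x y = (\<Sum>l\<in>L. of_real (e l) * w l x * cnj (w l y))"
  shows "fst p \<le> fst (\<Sum>l\<in>L. sign_pair (e l))" "snd p \<le> snd (\<Sum>l\<in>L. sign_pair (e l))"
proof -
  obtain J :: "nat set" and d z u where D: "diagonalizes V A J d z u"
    and p: "p = (\<Sum>j\<in>J. sign_pair (d j))"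
    using D by (auto simp: has_inertia_def)
  note J = diagonalizesD(1)[OF D]
  show "fst p \<le> fst (\<Sum>l\<in>L. sign_pair (e l))"
    using sylvester_positive[OF D finL L] by (simp add: p fst_sum_sign_pair J finL)
  have "diagonalizes V (\<lambda>x y. - A x y) J (\<lambda>j. - d j) z u"
    using D by (simp add: diagonalizes_def sum_negf)
  from sylvester_positive[OF this finL, of "\<lambda>l. - e l" w]
  show "snd p \<le> snd (\<Sum>l\<in>L. sign_pair (e l))"
    using L by (simp add: p snd_sum_sign_pair J finL sum_negf)
qed

lemma has_inertia_unique:
  assumes "has_inertia V A p" "has_inertia V A q"
  shows "p = q"
proof -
  have le: "fst a \<le> fst b \<and> snd a \<le> snd b" if a: "has_inertia V A a" and b: "has_inertia V A b" for a b
  proof -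
    obtain J :: "nat set" and d z u where D: "diagonalizes V A J d z u"
      and b: "b = (\<Sum>j\<in>J. sign_pair (d j))"
      using b by (auto simp: has_inertia_def)
    show ?thesis using sylvester_inertia[OF a diagonalizesD(1,2)[OF D]] unfolding b by blast
  qed
  show ?thesis using le[OF assms] le[OF assms(2,1)] by (simp add: prod_eq_iff)
qed

text \<open>
  Independent vectors on \<open>V\<close> number at most \<open>card V\<close>.
\<close>

lemma has_inertia_rank_le:
  assumes "has_inertia V A p" "finite V"
  shows "fst p + snd p \<le> card V"
proof -
  obtain J :: "nat set" and d z u where D: "diagonalizes V A J d z u"
    and p: "p = (\<Sum>j\<in>J. sign_pair (d j))"
    using assms by (auto simp: has_inertia_def)
  note D = diagonalizesD[OF D]
  have "card J \<le> card V"
  proof (rule ccontr)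
    assume "\<not> ?thesis"
    then have "card V < card J" by simp
    from homogeneous_system_nontrivial_solution[OF assms(2) D(1) this, of "\<lambda>x j. z j x"]
    obtain c where c: "\<exists>j\<in>J. c j \<noteq> 0" "\<And>x. x \<in> V \<Longrightarrow> (\<Sum>j\<in>J. c j * z j x) = 0" by auto
    have "c i = 0" if i: "i \<in> J" for i
    proof -
      have "0 = (\<Sum>x\<in>V. u i x * (\<Sum>j\<in>J. c j * z j x))" using c(2) by simp
      also have "\<dots> = (\<Sum>j\<in>J. c j * (\<Sum>x\<in>V. u i x * z j x))"
        unfolding sum_distrib_left by (subst sum.swap) (simp add: mult_ac)
      also have "\<dots> = (\<Sum>j\<in>J. if j = i then c j else 0)"
        using D(3)[OF i] by (intro sum.cong) auto
      finally show ?thesis using i D(1) by simp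
    qed
    with c(1) show False by blast
  qed
  moreover have "fst p + snd p = card ({j\<in>J. d j > 0} \<union> {j\<in>J. d j < 0})"
    by (subst card_Un_disjoint) (auto simp: p fst_sum_sign_pair snd_sum_sign_pair D(1))
  moreover have "\<dots> \<le> card J" by (intro card_mono D(1)) auto
  ultimately show ?thesis by linarith
qed

section \<open>Bordering a form by one vertex\<close>

text \<open>
  The way diagonalizations grow: a functional \<open>f\<close> that kills all \<open>z\<^sub>j\<close> but not \<open>w\<close> certifies that \<open>w\<close> is
  independent of them. Normalized, \<open>f\<close> is dual to \<open>w\<close>, and the old duals are corrected by multiples of
  it to vanish on \<open>w\<close>.
\<close>

lemma diagonalizes_insert:
  assumes V: "finite V" and D: "diagonalizes V A J d z u" and m: "m \<notin> J"
    and f: "\<And>j. j \<in> J \<Longrightarrow> (\<Sum>x\<in>V. f x * z j x) = 0" "(\<Sum>x\<in>V. f x * w x) \<noteq> 0"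
  shows "\<exists>u'. diagonalizes V (\<lambda>x y. A x y + of_real t * w x * cnj (w y))
    (insert m J) (d(m := t)) (z(m := w)) u'"
proof -
  note D = diagonalizesD[OF D]
  define g where "g x = f x / (\<Sum>x\<in>V. f x * w x)" for x
  define u' where "u' j = (if j = m then g else (\<lambda>x. u j x - (\<Sum>a\<in>V. u j a * w a) * g x))" for j
  have g: "(\<Sum>x\<in>V. g x * h x) = (\<Sum>x\<in>V. f x * h x) / (\<Sum>x\<in>V. f x * w x)" for h
    by (simp add: g_def sum_divide_distrib)
  have u': "(\<Sum>x\<in>V. u' j x * h x) =
      (\<Sum>x\<in>V. u j x * h x) - (\<Sum>a\<in>V. u j a * w a) * (\<Sum>x\<in>V. g x * h x)" if "j \<noteq> m" for j h
    using that by (simp add: u'_def left_diff_distrib sum_subtractf sum_distrib_left mult.assoc)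
  have "diagonalizes V (\<lambda>x y. A x y + of_real t * w x * cnj (w y))
    (insert m J) (d(m := t)) (z(m := w)) u'"
    unfolding diagonalizes_def
  proof (intro conjI ballI)
    show "finite (insert m J)" using D(1) by simp
    fix x y assume xy: "x \<in> V" "y \<in> V"
    have "(\<Sum>j\<in>J. of_real ((d(m := t)) j) * (z(m := w)) j x * cnj ((z(m := w)) j y)) = A x y"
      unfolding D(2)[OF xy] using m by (intro sum.cong refl) auto
    then show "A x y + of_real t * w x * cnj (w y) =
        (\<Sum>j\<in>insert m J. of_real ((d(m := t)) j) * (z(m := w)) j x * cnj ((z(m := w)) j y))"
      using D(1) m by simp
  next
    fix i j assume ij: "i \<in> insert m J" "j \<in> insert m J"
    show "(\<Sum>x\<in>V. u' i x * (z(m := w)) j x) = of_bool (i = j)"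
    proof (cases "i = m")
      case True
      then have "u' i = g" by (simp add: u'_def)
      then show ?thesis using True ij(2) f by (cases "j = m") (auto simp: g)
    next
      case False
      then have i: "i \<in> J" using ij by simp
      show ?thesis
      proof (cases "j = m")
        case True
        then show ?thesis using False f(2) by (simp add: u' g)
      next
        case j: False
        then have "j \<in> J" using ij by simp
        then show ?thesis using j D(3)[OF i] f(1) by (simp add: u'[OF False] g)
      qed
    qed
  qed
  then show ?thesis by blast
qed

text \<open>
  Extending the vectors to a new vertex \<open>v\<close>, with arbitrary values \<open>c j\<close> there, preserves independence,
  because the old functionals extend by \<open>0\<close>.
\<close>

lemma diagonalizes_zero_extension:
  assumes W: "finite W" "v \<notin> W" and D: "diagonalizes W A J d z u"
  shows "diagonalizes (insert v W)
    (\<lambda>x y. \<Sum>j\<in>J. of_real (d j) * (if x = v then c j else z j x) * cnj (if y = v then c j else z j y))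
    J d (\<lambda>j x. if x = v then c j else z j x) (\<lambda>j x. if x = v then 0 else u j x)"
  unfolding diagonalizes_def
proof (intro conjI ballI refl)
  note D = diagonalizesD[OF D]
  show "finite J" by (rule D(1))
  fix i j assume ij: "i \<in> J" "j \<in> J"
  have "(\<Sum>x\<in>W. (if x = v then 0 else u i x) * (if x = v then c j else z j x)) = (\<Sum>x\<in>W. u i x * z j x)"
    using W(2) by (intro sum.cong refl) auto
  then show "(\<Sum>x\<in>insert v W. (if x = v then 0 else u i x) * (if x = v then c j else z j x)) = of_bool (i = j)"
    using W D(3)[OF ij] by simp
qed

text \<open>
  Completing the square: if the column of \<open>v\<close> is the image of \<open>h\<close>, then extending each \<open>z\<^sub>j\<close> to \<open>v\<close> by
  the value \<open>(\<Sum>y\<in>W. z\<^sub>j y * cnj (h y))\<close> reproduces that column, and only the entry at \<open>(v, v)\<close> is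
  left over. It differs by the Schur complement, which enters as coefficient of the unit vector at \<open>v\<close>.
\<close>

lemma border_inertia_in_range:
  assumes W: "finite W" "v \<notin> W" and herm: "hermitian_on (insert v W) A"
    and p: "has_inertia W A p"
    and h: "\<And>x. x \<in> W \<Longrightarrow> A x v = (\<Sum>y\<in>W. A x y * h y)"
  shows "has_inertia (insert v W) A
    (p + sign_pair (Re (A v v - (\<Sum>x\<in>W. cnj (h x) * A x v))))"
proof -
  obtain J :: "nat set" and d z u where D: "diagonalizes W A J d z u"
    and p: "p = (\<Sum>j\<in>J. sign_pair (d j))"
    using p unfolding has_inertia_def by blast
  note D' = diagonalizesD[OF D]
  define t where "t = Re (A v v - (\<Sum>x\<in>W. cnj (h x) * A x v))"
  define c where "c j = (\<Sum>y\<in>W. z j y * cnj (h y))" for j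
  define w where "w j x = (if x = v then c j else z j x)" for j x
  define e where "e x = (of_bool (x = v) :: complex)" for x
  define f where "f x = (if x = v then 1 else - (\<Sum>j\<in>J. c j * u j x))" for x
  define A0 where "A0 x y = (\<Sum>j\<in>J. of_real (d j) * w j x * cnj (w j y))" for x y
  have ext: "diagonalizes (insert v W) A0 J d w (\<lambda>j x. if x = v then 0 else u j x)"
    using diagonalizes_zero_extension[OF W D, of c] unfolding A0_def[abs_def] w_def[abs_def] by simp
  obtain m where m: "m \<notin> J" using ex_new_if_finite[OF infinite_UNIV_nat D'(1)] by blast
  have fe: "(\<Sum>x\<in>insert v W. f x * e x) \<noteq> 0"
  proof -
    have "(\<Sum>x\<in>W. f x * e x) = 0" using W(2) by (intro sum.neutral) (auto simp: e_def)
    then show ?thesis using W by (simp add: f_def e_def)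
  qed
  have fw: "(\<Sum>x\<in>insert v W. f x * w k x) = 0" if k: "k \<in> J" for k
  proof -
    have "(\<Sum>x\<in>W. f x * w k x) = - (\<Sum>x\<in>W. \<Sum>j\<in>J. c j * (u j x * z k x))"
      using W(2) by (subst sum_negf[symmetric], intro sum.cong refl)
        (auto simp: f_def w_def sum_distrib_right mult.assoc)
    also have "\<dots> = - (\<Sum>j\<in>J. c j * (\<Sum>x\<in>W. u j x * z k x))"
      by (subst sum.swap) (simp add: sum_distrib_left)
    also have "\<dots> = - (\<Sum>j\<in>J. if j = k then c j else 0)"
      using D'(3)[OF _ k] by (intro arg_cong[of _ _ uminus] sum.cong) auto
    also have "\<dots> = - c k" using D'(1) k by simp
    finally show ?thesis using W by (simp add: f_def w_def)
  qed
  obtain u' where u': "diagonalizes (insert v W) (\<lambda>x y. A0 x y + of_real t * e x * cnj (e y))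
      (insert m J) (d(m := t)) (w(m := e)) u'"
    using diagonalizes_insert[OF _ ext m fw fe, of t] W(1) by blast
  have "(\<Sum>j\<in>insert m J. sign_pair ((d(m := t)) j)) = p + sign_pair t"
  proof -
    have "(\<Sum>j\<in>J. sign_pair ((d(m := t)) j)) = p" unfolding p using m by (intro sum.cong) auto
    then show ?thesis using m D'(1) by (simp add: add.commute)
  qed
  then have inertia: "has_inertia (insert v W) (\<lambda>x y. A0 x y + of_real t * e x * cnj (e y)) (p + sign_pair t)"
    using has_inertiaI[OF u'] by simp
  have A0W: "A0 x y = A x y" if "x \<in> W" "y \<in> W" for x y
    using that W(2) D'(2)[OF that] unfolding A0_def w_def by (auto intro!: sum.cong)
  have Av: "A x v = (\<Sum>j\<in>J. of_real (d j) * z j x * cnj (c j))" if x: "x \<in> W" for x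
  proof -
    have "A x v = (\<Sum>y\<in>W. \<Sum>j\<in>J. of_real (d j) * z j x * (cnj (z j y) * h y))"
      unfolding h[OF x] using D'(2)[OF x] by (intro sum.cong refl) (simp add: sum_distrib_right mult.assoc)
    also have "\<dots> = (\<Sum>j\<in>J. of_real (d j) * z j x * cnj (c j))"
      by (subst sum.swap) (simp add: c_def sum_distrib_left)
    finally show ?thesis .
  qed
  have A0v: "A0 x v = A x v" if x: "x \<in> W" for x
  proof -
    have "x \<noteq> v" using x W(2) by blast
    then show ?thesis by (simp add: Av[OF x] A0_def w_def)
  qed
  have hermA0: "A0 y x = cnj (A0 x y)" for x y by (simp add: A0_def mult_ac)
  have A0vv: "A0 v v = (\<Sum>x\<in>W. cnj (h x) * A x v)"
  proof -
    have "(\<Sum>x\<in>W. cnj (h x) * A x v) = (\<Sum>x\<in>W. \<Sum>j\<in>J. of_real (d j) * (z j x * cnj (h x)) * cnj (c j))"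
      by (intro sum.cong refl) (simp add: Av sum_distrib_left mult_ac)
    also have "\<dots> = (\<Sum>j\<in>J. of_real (d j) * (\<Sum>x\<in>W. z j x * cnj (h x)) * cnj (c j))"
      by (subst sum.swap) (simp add: sum_distrib_left sum_distrib_right)
    finally show ?thesis by (simp add: A0_def w_def c_def[symmetric])
  qed
  have tvv: "A v v = A0 v v + of_real t"
  proof -
    have "A0 v v = of_real (Re (A0 v v))"
      using hermA0[of v v] by (metis Reals_cnj_iff of_real_Re)
    moreover have "A v v = of_real (Re (A v v))"
      using hermitian_on_diagonal_real[OF herm, of v] by simp
    ultimately show ?thesis unfolding t_def A0vv[symmetric]
      by (metis add_diff_cancel_left' diff_add_cancel minus_complex.simps(1) of_real_diff add.commute)
  qed
  show ?thesis unfolding t_def[symmetric]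
  proof (rule has_inertia_cong[OF inertia])
    fix x y assume xy: "x \<in> insert v W" "y \<in> insert v W"
    show "A0 x y + of_real t * e x * cnj (e y) = A x y"
    proof (cases "x = v")
      case x: True
      show ?thesis
      proof (cases "y = v")
        case True then show ?thesis using x tvv by (simp add: e_def)
      next
        case False
        then have y: "y \<in> W" using xy by simp
        have "A0 v y = A v y"
          using hermA0[of y v] A0v[OF y] hermitian_onD[OF herm, of y v] y by simp
        then show ?thesis using x False by (simp add: e_def)
      qed
    next
      case False
      then show ?thesis using xy A0W A0v by (cases "y = v") (auto simp: e_def)
    qed
  qed
qed

text \<open>
  If the column \<open>x\<close> of \<open>v\<close> is not in the range, it is independent of the \<open>z\<^sub>j\<close>. With \<open>a\<close> the entry at
  \<open>(v, v)\<close>, \<open>e\<close> the unit vector at \<open>v\<close> and \<open>y = x + a/2 e\<close>, the bordering adds the form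
  \<open>y e\<^sup>* + e y\<^sup>* = 1/2 (y + e) (y + e)\<^sup>* - 1/2 (y - e) (y - e)\<^sup>*\<close>, a hyperbolic plane, which contributes one
  positive and one negative coefficient.
\<close>

lemma border_inertia_out_of_range:
  assumes W: "finite W" "v \<notin> W" and herm: "hermitian_on (insert v W) A"
    and p: "has_inertia W A p"
    and h: "\<not> (\<exists>h. \<forall>x\<in>W. A x v = (\<Sum>y\<in>W. A x y * h y))"
  shows "has_inertia (insert v W) A (p + (1, 1))"
proof -
  obtain J :: "nat set" and d z u where D: "diagonalizes W A J d z u" and d0: "\<forall>j\<in>J. d j \<noteq> 0"
    and p: "p = (\<Sum>j\<in>J. sign_pair (d j))"
    using has_inertiaE[OF p] .
  note D' = diagonalizesD[OF D]
  define \<alpha> where "\<alpha> j = (\<Sum>x\<in>W. u j x * A x v)" for j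
  have "\<exists>q\<in>W. A q v - (\<Sum>j\<in>J. z j q * \<alpha> j) \<noteq> 0"
  proof (rule ccontr)
    assume no: "\<not> ?thesis"
    \<comment> \<open>If the column were the combination \<open>\<Sum>j. \<alpha>\<^sub>j z\<^sub>j\<close>, this \<open>h\<close> would be a preimage of it.\<close>
    define h where "h y = (\<Sum>j\<in>J. cnj (u j y) * (\<alpha> j / of_real (d j)))" for y
    have hz: "(\<Sum>y\<in>W. cnj (z k y) * h y) = \<alpha> k / of_real (d k)" if k: "k \<in> J" for k
    proof -
      have "(\<Sum>y\<in>W. cnj (z k y) * h y) =
          (\<Sum>j\<in>J. cnj (\<Sum>y\<in>W. u j y * z k y) * (\<alpha> j / of_real (d j)))"
        unfolding h_def sum_distrib_left cnj_sum sum_distrib_right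
        by (subst sum.swap) (simp add: mult_ac)
      also have "\<dots> = (\<Sum>j\<in>J. if j = k then \<alpha> j / of_real (d j) else 0)"
        using D'(3)[OF _ k] by (intro sum.cong) auto
      finally show ?thesis using D'(1) k by simp
    qed
    have "A x v = (\<Sum>y\<in>W. A x y * h y)" if x: "x \<in> W" for x
    proof -
      have "(\<Sum>y\<in>W. A x y * h y) = (\<Sum>y\<in>W. \<Sum>k\<in>J. of_real (d k) * z k x * (cnj (z k y) * h y))"
        using D'(2)[OF x] by (intro sum.cong refl) (simp add: sum_distrib_right mult.assoc)
      also have "\<dots> = (\<Sum>k\<in>J. of_real (d k) * z k x * (\<Sum>y\<in>W. cnj (z k y) * h y))"
        by (subst sum.swap) (simp add: sum_distrib_left)
      also have "\<dots> = (\<Sum>k\<in>J. z k x * \<alpha> k)"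
        using d0 by (intro sum.cong refl) (auto simp: hz)
      finally show ?thesis using no x by simp
    qed
    then show False using h by blast
  qed
  then obtain q where q: "q \<in> W" "A q v - (\<Sum>j\<in>J. z j q * \<alpha> j) \<noteq> 0" by blast
  define \<rho> where "\<rho> = A q v - (\<Sum>j\<in>J. z j q * \<alpha> j)"
  have \<rho>: "\<rho> \<noteq> 0" using q(2) by (simp add: \<rho>_def)
  \<comment> \<open>Evaluation at \<open>q\<close> after the projection along the \<open>z\<^sub>j\<close>: it kills them and takes the column to \<open>\<rho>\<close>.\<close>
  define f where "f x = (if x = v then 0 else of_bool (x = q) - (\<Sum>j\<in>J. z j q * u j x))" for x
  have f: "(\<Sum>x\<in>insert v W. f x * g x) = g q - (\<Sum>j\<in>J. z j q * (\<Sum>x\<in>W. u j x * g x))" for g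
  proof -
    have "(\<Sum>x\<in>insert v W. f x * g x) = (\<Sum>x\<in>W. f x * g x)" using W by (simp add: f_def)
    also have "\<dots> = (\<Sum>x\<in>W. (if x = q then g x else 0) - (\<Sum>j\<in>J. z j q * (u j x * g x)))"
      using W(2) by (intro sum.cong refl) (auto simp: f_def left_diff_distrib sum_distrib_right mult.assoc)
    also have "\<dots> = g q - (\<Sum>x\<in>W. \<Sum>j\<in>J. z j q * (u j x * g x))"
      using W(1) q(1) by (simp add: sum_subtractf)
    also have "(\<Sum>x\<in>W. \<Sum>j\<in>J. z j q * (u j x * g x)) = (\<Sum>j\<in>J. z j q * (\<Sum>x\<in>W. u j x * g x))"
      by (subst sum.swap) (simp add: sum_distrib_left)
    finally show ?thesis .
  qed
  define a where "a = A v v"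
  have a: "cnj a = a" using hermitian_onD[OF herm, of v v] by (simp add: a_def)
  \<comment> \<open>The vectors \<open>y + e\<close> and \<open>y - e\<close>.\<close>
  define y1 where "y1 x = (if x = v then a / 2 + 1 else A x v)" for x
  define y2 where "y2 x = (if x = v then a / 2 - 1 else A x v)" for x
  define w where "w j x = (if x = v then 0 else z j x)" for j x
  define A0 where "A0 x y = (\<Sum>j\<in>J. of_real (d j) * w j x * cnj (w j y))" for x y
  have ext: "diagonalizes (insert v W) A0 J d w (\<lambda>j x. if x = v then 0 else u j x)"
    using diagonalizes_zero_extension[OF W D, of "\<lambda>_. 0"] unfolding A0_def[abs_def] w_def[abs_def] by simp
  have qv: "q \<noteq> v" using q(1) W(2) by auto
  have restrict: "(\<Sum>x\<in>W. u j x * g x) = (\<Sum>x\<in>W. u j x * g' x)" if "\<And>x. x \<in> W \<Longrightarrow> g x = g' x" for j g g'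
    using that by (intro sum.cong) auto
  have fw: "(\<Sum>x\<in>insert v W. f x * w k x) = 0" if k: "k \<in> J" for k
  proof -
    have "(\<Sum>j\<in>J. z j q * (\<Sum>x\<in>W. u j x * w k x)) = (\<Sum>j\<in>J. if j = k then z j q else 0)"
    proof (intro sum.cong refl)
      fix j assume j: "j \<in> J"
      have "(\<Sum>x\<in>W. u j x * w k x) = of_bool (j = k)"
        unfolding D'(3)[OF j k, symmetric] using W(2) by (intro restrict) (auto simp: w_def)
      then show "z j q * (\<Sum>x\<in>W. u j x * w k x) = (if j = k then z j q else 0)" by simp
    qed
    then show ?thesis using D'(1) k qv by (simp add: f w_def)
  qed
  have fy: "(\<Sum>x\<in>insert v W. f x * g x) = \<rho>" if "\<And>x. x \<in> W \<Longrightarrow> g x = A x v" for g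
  proof -
    have "(\<Sum>x\<in>W. u j x * g x) = \<alpha> j" for j unfolding \<alpha>_def using that by (intro restrict) auto
    then show ?thesis using that[OF q(1)] by (simp add: f \<rho>_def)
  qed
  have yA: "x \<in> W \<Longrightarrow> y1 x = A x v" "x \<in> W \<Longrightarrow> y2 x = A x v" for x
    using W(2) by (auto simp: y1_def y2_def)
  obtain m where m: "m \<notin> J" using ex_new_if_finite[OF infinite_UNIV_nat D'(1)] by blast
  obtain m' where m': "m' \<notin> insert m J"
    using ex_new_if_finite[OF infinite_UNIV_nat, of "insert m J"] D'(1) by blast
  have "(\<Sum>x\<in>insert v W. f x * y1 x) \<noteq> 0" using fy[OF yA(1)] \<rho> by simp
  from diagonalizes_insert[OF _ ext m fw this, of "1/2"] W(1)
  obtain u1 where u1: "diagonalizes (insert v W) (\<lambda>x y. A0 x y + of_real (1/2) * y1 x * cnj (y1 y))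
      (insert m J) (d(m := 1/2)) (w(m := y1)) u1" by blast
  \<comment> \<open>The combination of \<open>f\<close> and evaluation at \<open>v\<close> that vanishes on \<open>y + e\<close>; its value on \<open>y - e\<close> is \<open>- 2\<close>.\<close>
  define \<phi> where "\<phi> x = - (a / 2 + 1) / \<rho> * f x + of_bool (x = v)" for x
  have \<phi>: "(\<Sum>x\<in>insert v W. \<phi> x * g x) = - (a / 2 + 1) / \<rho> * (\<Sum>x\<in>insert v W. f x * g x) + g v" for g
  proof -
    have "(\<Sum>x\<in>insert v W. of_bool (x = v) * g x) = (\<Sum>x\<in>insert v W. if x = v then g x else 0)"
      by (intro sum.cong) auto
    also have "\<dots> = g v" using W by simp
    finally show ?thesis
      by (simp add: \<phi>_def distrib_right sum.distrib sum_distrib_left mult.assoc del: sum.insert)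
  qed
  have \<phi>1: "(\<Sum>x\<in>insert v W. \<phi> x * (w(m := y1)) k x) = 0" if "k \<in> insert m J" for k
  proof (cases "k = m")
    case True
    then show ?thesis using fy[OF yA(1)] \<rho> by (simp add: \<phi> y1_def del: sum.insert)
  next
    case False
    then show ?thesis using fw[of k] that by (simp add: \<phi> w_def del: sum.insert)
  qed
  have \<phi>2: "(\<Sum>x\<in>insert v W. \<phi> x * y2 x) \<noteq> 0"
    using fy[OF yA(2)] \<rho> by (simp add: \<phi> y2_def del: sum.insert)
  from diagonalizes_insert[OF _ u1 m' \<phi>1 \<phi>2, of "- 1/2"] W(1)
  obtain u2 where u2: "diagonalizes (insert v W)
      (\<lambda>x y. A0 x y + of_real (1/2) * y1 x * cnj (y1 y) + of_real (- 1/2) * y2 x * cnj (y2 y))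
      (insert m' (insert m J)) (d(m := 1/2, m' := - 1/2)) (w(m := y1, m' := y2)) u2"
    by blast
  have "(\<Sum>j\<in>insert m' (insert m J). sign_pair ((d(m := 1/2, m' := - 1/2)) j)) = p + (1, 1)"
  proof -
    have "(\<Sum>j\<in>J. sign_pair ((d(m := 1/2, m' := - 1/2)) j)) = p"
      unfolding p using m m' by (intro sum.cong) auto
    then show ?thesis using m m' D'(1) by (simp add: prod_eq_iff)
  qed
  note inertia = has_inertiaI[OF u2 this[symmetric]]
  show ?thesis
  proof (rule has_inertia_cong[OF inertia])
    fix x y assume xy: "x \<in> insert v W" "y \<in> insert v W"
    have A0v: "A0 x v = 0" "A0 v x = 0" for x by (simp_all add: A0_def w_def)
    have A0W: "A0 x y = A x y" if "x \<in> W" "y \<in> W" for x y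
      using that W(2) D'(2)[OF that] unfolding A0_def w_def by (auto intro!: sum.cong)
    show "A0 x y + of_real (1/2) * y1 x * cnj (y1 y) + of_real (- 1/2) * y2 x * cnj (y2 y) = A x y"
    proof (cases "x = v")
      case x: True
      show ?thesis
      proof (cases "y = v")
        case True then show ?thesis using x a by (simp add: A0v y1_def y2_def a_def algebra_simps)
      next
        case False
        then have y: "y \<in> W" using xy by simp
        have "A v y = cnj (A y v)" using hermitian_onD[OF herm, of y v] y by simp
        then show ?thesis using x False by (simp add: A0v y1_def y2_def algebra_simps)
      qed
    next
      case False
      then have x: "x \<in> W" using xy by simp
      show ?thesis
      proof (cases "y = v")
        case True
        then show ?thesis using False a by (simp add: A0v y1_def y2_def field_simps)
      next
        case False
        then show ?thesis using xy x \<open>x \<noteq> v\<close> A0W[of x y] by (simp add: y1_def y2_def)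
      qed
    qed
  qed
qed

text \<open>
  Add the vertices one by one; in either case of bordering a diagonalization extends.
\<close>

lemma has_inertia_exists:
  assumes "finite V" "hermitian_on V A"
  shows "\<exists>p. has_inertia V A p"
  using assms
proof (induction V rule: finite_induct)
  case empty
  have "diagonalizes {} A ({} :: nat set) (\<lambda>_. 0) (\<lambda>_ _. 0) (\<lambda>_ _. 0)"
    by (simp add: diagonalizes_def)
  then show ?case using has_inertiaI by blast
next
  case (insert v W)
  then obtain p where "has_inertia W A p" using hermitian_on_subset by blast
  then show ?case
    using border_inertia_in_range[OF insert(1,2,4)] border_inertia_out_of_range[OF insert(1,2,4)]
    by blast
qed

lemma border_inertia_le:
  assumes "finite W" "v \<notin> W" "hermitian_on (insert v W) A" "has_inertia W A p"
  obtains q where "has_inertia (insert v W) A q" "fst q \<le> fst p + 1" "snd q \<le> snd p + 1"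
proof (cases "\<exists>h. \<forall>x\<in>W. A x v = (\<Sum>y\<in>W. A x y * h y)")
  case True
  then obtain h where "\<And>x. x \<in> W \<Longrightarrow> A x v = (\<Sum>y\<in>W. A x y * h y)" by blast
  from border_inertia_in_range[OF assms this] show thesis
    by (rule that) (simp_all add: sign_pair_def)
next
  case False
  from border_inertia_out_of_range[OF assms False] show thesis by (rule that) simp_all
qed

section \<open>Perturbing the diagonal\<close>

text \<open>
  If \<open>V\<close> has more elements than the form has rank, some unit vector is independent of the \<open>z\<^sub>j\<close>, and
  adding a multiple \<open>t\<close> of its square changes one diagonal entry and adds the sign of \<open>t\<close> to the
  inertia. Such a unit vector exists by a trace argument: \<open>\<Sum>j. z\<^sub>j u\<^sub>j\<close> is a projection whose rank equals that
  of the form, so its diagonal entries cannot all be \<open>1\<close>.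
\<close>

lemma perturb_diagonal_entry:
  assumes V: "finite V" and p: "has_inertia V A p" "fst p + snd p < card V"
  obtains a where "a \<in> V"
    "\<And>t. has_inertia V (\<lambda>x y. A x y + of_real t * of_bool (x = a) * of_bool (y = a)) (p + sign_pair t)"
proof -
  obtain J :: "nat set" and d z u where D: "diagonalizes V A J d z u" and d0: "\<forall>j\<in>J. d j \<noteq> 0"
    and p_eq: "p = (\<Sum>j\<in>J. sign_pair (d j))"
    using has_inertiaE[OF p(1)] .
  note D' = diagonalizesD[OF D]
  have "fst p + snd p = (\<Sum>j\<in>J. fst (sign_pair (d j)) + snd (sign_pair (d j)))"
    by (simp add: p_eq fst_sum snd_sum sum.distrib)
  also have "\<dots> = (\<Sum>j\<in>J. 1)" using d0 by (intro sum.cong refl) (auto simp: sign_pair_def)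
  finally have card: "card J < card V" using p(2) by simp
  have "\<exists>a\<in>V. (\<Sum>j\<in>J. u j a * z j a) \<noteq> 1"
  proof (rule ccontr)
    assume "\<not> ?thesis"
    then have "of_nat (card V) = (\<Sum>a\<in>V. \<Sum>j\<in>J. u j a * z j a)" by simp
    also have "\<dots> = (\<Sum>j\<in>J. \<Sum>a\<in>V. u j a * z j a)" by (rule sum.swap)
    also have "\<dots> = (\<Sum>j\<in>J. 1)" using D'(3) by (intro sum.cong) auto
    finally show False using card by simp
  qed
  then obtain a where a: "a \<in> V" "(\<Sum>j\<in>J. u j a * z j a) \<noteq> 1" by blast
  \<comment> \<open>Evaluation at \<open>a\<close> after the projection along the \<open>z\<^sub>j\<close>.\<close>
  define f where "f x = of_bool (x = a) - (\<Sum>j\<in>J. z j a * u j x)" for x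
  have f: "(\<Sum>x\<in>V. f x * g x) = g a - (\<Sum>j\<in>J. z j a * (\<Sum>x\<in>V. u j x * g x))" for g
  proof -
    have "(\<Sum>x\<in>V. f x * g x) = (\<Sum>x\<in>V. (if x = a then g x else 0) - (\<Sum>j\<in>J. z j a * (u j x * g x)))"
      by (intro sum.cong refl) (auto simp: f_def left_diff_distrib sum_distrib_right mult.assoc)
    also have "\<dots> = g a - (\<Sum>x\<in>V. \<Sum>j\<in>J. z j a * (u j x * g x))"
      using V a(1) by (simp add: sum_subtractf)
    also have "(\<Sum>x\<in>V. \<Sum>j\<in>J. z j a * (u j x * g x)) = (\<Sum>j\<in>J. z j a * (\<Sum>x\<in>V. u j x * g x))"
      by (subst sum.swap) (simp add: sum_distrib_left)
    finally show ?thesis .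
  qed
  have fz: "(\<Sum>x\<in>V. f x * z k x) = 0" if k: "k \<in> J" for k
  proof -
    have "(\<Sum>j\<in>J. z j a * (\<Sum>x\<in>V. u j x * z k x)) = (\<Sum>j\<in>J. if j = k then z j a else 0)"
      using D'(3)[OF _ k] by (intro sum.cong) auto
    then show ?thesis using D'(1) k by (simp add: f)
  qed
  have u_unit: "(\<Sum>x\<in>V. u j x * of_bool (x = a)) = u j a" for j
  proof -
    have "(\<Sum>x\<in>V. u j x * of_bool (x = a)) = (\<Sum>x\<in>V. if x = a then u j x else 0)"
      by (intro sum.cong) auto
    then show ?thesis using V a(1) by simp
  qed
  have fa: "(\<Sum>x\<in>V. f x * of_bool (x = a)) \<noteq> 0"
    unfolding f u_unit using a(2) by (simp add: mult.commute)
  obtain m where m: "m \<notin> J" using ex_new_if_finite[OF infinite_UNIV_nat D'(1)] by blast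
  have "has_inertia V (\<lambda>x y. A x y + of_real t * of_bool (x = a) * of_bool (y = a)) (p + sign_pair t)" for t
  proof -
    obtain u' where u': "diagonalizes V (\<lambda>x y. A x y + of_real t * of_bool (x = a) * cnj (of_bool (y = a)))
        (insert m J) (d(m := t)) (z(m := \<lambda>x. of_bool (x = a))) u'"
      using diagonalizes_insert[OF V D m fz fa] by blast
    have "(\<Sum>j\<in>J. sign_pair ((d(m := t)) j)) = p" unfolding p_eq using m by (intro sum.cong) auto
    then have "(\<Sum>j\<in>insert m J. sign_pair ((d(m := t)) j)) = p + sign_pair t"
      using m D'(1) by (simp add: add.commute)
    from has_inertia_cong[OF has_inertiaI[OF u' this[symmetric]]] show ?thesis by simp
  qed
  then show thesis using that a(1) by blast
qed

section \<open>Direct sums and subadditivity\<close>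

lemma has_inertia_family:
  assumes "\<And>i. i \<in> I \<Longrightarrow> has_inertia (V i) (B i) (p i)"
  obtains J :: "'i \<Rightarrow> nat set" and d z u where
    "\<And>i. i \<in> I \<Longrightarrow> diagonalizes (V i) (B i) (J i) (d i) (z i) (u i)"
    "\<And>i. i \<in> I \<Longrightarrow> p i = (\<Sum>j\<in>J i. sign_pair (d i j))"
proof -
  have "\<forall>i\<in>I. \<exists>Q :: nat set \<times> (nat \<Rightarrow> real) \<times> (nat \<Rightarrow> 'a \<Rightarrow> complex) \<times> (nat \<Rightarrow> 'a \<Rightarrow> complex).
      diagonalizes (V i) (B i) (fst Q) (fst (snd Q)) (fst (snd (snd Q))) (snd (snd (snd Q))) \<and>
      p i = (\<Sum>j\<in>fst Q. sign_pair (fst (snd Q) j))"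
    using assms unfolding has_inertia_def by fastforce
  from bchoice[OF this]
  obtain f :: "'i \<Rightarrow> nat set \<times> (nat \<Rightarrow> real) \<times> (nat \<Rightarrow> 'a \<Rightarrow> complex) \<times> (nat \<Rightarrow> 'a \<Rightarrow> complex)"
    where f: "\<forall>i\<in>I.
      diagonalizes (V i) (B i) (fst (f i)) (fst (snd (f i))) (fst (snd (snd (f i)))) (snd (snd (snd (f i)))) \<and>
      p i = (\<Sum>j\<in>fst (f i). sign_pair (fst (snd (f i)) j))"
    by blast
  show thesis
    by (rule that[of "\<lambda>i. fst (f i)" "\<lambda>i. fst (snd (f i))" "\<lambda>i. fst (snd (snd (f i)))"
          "\<lambda>i. snd (snd (snd (f i)))"]) (use f in blast)+
qed

text \<open>
  Diagonalizations of the blocks, extended by zero, together diagonalize the whole form.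
\<close>

lemma direct_sum_inertia:
  assumes I: "finite I" and W: "\<And>i. i \<in> I \<Longrightarrow> finite (W i)"
    and disj: "\<And>i j. i \<in> I \<Longrightarrow> j \<in> I \<Longrightarrow> i \<noteq> j \<Longrightarrow> W i \<inter> W j = {}"
    and p: "\<And>i. i \<in> I \<Longrightarrow> has_inertia (W i) A (p i)"
    and zero: "\<And>i j x y. i \<in> I \<Longrightarrow> j \<in> I \<Longrightarrow> i \<noteq> j \<Longrightarrow> x \<in> W i \<Longrightarrow> y \<in> W j \<Longrightarrow> A x y = 0"
  shows "has_inertia (\<Union>i\<in>I. W i) A (\<Sum>i\<in>I. p i)"
proof -
  obtain J :: "'a \<Rightarrow> nat set" and d z u where
    D: "\<And>i. i \<in> I \<Longrightarrow> diagonalizes (W i) A (J i) (d i) (z i) (u i)"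
    and p_eq: "\<And>i. i \<in> I \<Longrightarrow> p i = (\<Sum>j\<in>J i. sign_pair (d i j))"
    using has_inertia_family[of I W "\<lambda>_. A" p, OF p] by blast
  note D' = diagonalizesD[OF D]
  define z' where "z' k x = (if x \<in> W (fst k) then z (fst k) (snd k) x else 0)" for k x
  define u' where "u' k x = (if x \<in> W (fst k) then u (fst k) (snd k) x else 0)" for k x
  define d' where "d' k = d (fst k) (snd k)" for k
  have fin: "\<forall>i\<in>I. finite (J i)" using D'(1) by blast
  have "diagonalizes (\<Union>i\<in>I. W i) A (Sigma I J) d' z' u'"
    unfolding diagonalizes_def
  proof (intro conjI ballI)
    show "finite (Sigma I J)" using I fin by blast
    fix x y assume "x \<in> (\<Union>i\<in>I. W i)" "y \<in> (\<Union>i\<in>I. W i)"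
    then obtain a b where a: "a \<in> I" "x \<in> W a" and b: "b \<in> I" "y \<in> W b" by blast
    have x: "x \<in> W i \<longleftrightarrow> i = a" and y: "y \<in> W i \<longleftrightarrow> i = b" if "i \<in> I" for i
      using disj[OF that a(1)] disj[OF that b(1)] a b by blast+
    have "(\<Sum>k\<in>Sigma I J. of_real (d' k) * z' k x * cnj (z' k y)) =
        (\<Sum>i\<in>I. \<Sum>j\<in>J i. of_real (d' (i, j)) * z' (i, j) x * cnj (z' (i, j) y))"
      by (subst sum.Sigma[OF I fin]) simp
    also have "\<dots> = (\<Sum>i\<in>I. if i = a then (if a = b then A x y else 0) else 0)"
    proof (intro sum.cong refl)
      fix i assume i: "i \<in> I"
      show "(\<Sum>j\<in>J i. of_real (d' (i, j)) * z' (i, j) x * cnj (z' (i, j) y)) =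
          (if i = a then (if a = b then A x y else 0) else 0)"
        using x[OF i] y[OF i] D'(2)[OF a(1), of x y] a b by (auto simp: z'_def d'_def)
    qed
    also have "\<dots> = A x y" using I a b zero[OF a(1) b(1) _ a(2) b(2)] by auto
    finally show "A x y = (\<Sum>k\<in>Sigma I J. of_real (d' k) * z' k x * cnj (z' k y))" by simp
  next
    fix k l assume "k \<in> Sigma I J" "l \<in> Sigma I J"
    then obtain i j i' j' where k: "k = (i, j)" "i \<in> I" "j \<in> J i" and l: "l = (i', j')" "i' \<in> I" "j' \<in> J i'"
      by blast
    show "(\<Sum>x\<in>(\<Union>i\<in>I. W i). u' k x * z' l x) = of_bool (k = l)"
    proof (cases "i = i'")
      case True
      have "(\<Sum>x\<in>(\<Union>i\<in>I. W i). u' k x * z' l x) = (\<Sum>x\<in>W i. u i j x * z i j' x)"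
        using I W k l True by (intro sum.mono_neutral_cong_right) (auto simp: u'_def z'_def)
      then show ?thesis using D'(3)[OF k(2,3), of j'] k l True by simp
    next
      case False
      then show ?thesis using disj[OF k(2) l(2)] k l
        by (intro trans[OF sum.neutral]) (auto simp: u'_def z'_def)
    qed
  qed
  moreover have "(\<Sum>k\<in>Sigma I J. sign_pair (d' k)) = (\<Sum>i\<in>I. p i)"
    using sum.Sigma[OF I fin, of "\<lambda>i j. sign_pair (d i j)"] p_eq by (simp add: d'_def case_prod_beta)
  ultimately show ?thesis using has_inertiaI by metis
qed

text \<open>
  Decompositions of the summands, extended by zero, together decompose the sum of the forms. They may
  become dependent, so Sylvester's law yields only an upper bound. The sets \<open>V i\<close> may overlap.
\<close>

lemma inertia_subadditive:
  assumes I: "finite I" and p: "\<And>i. i \<in> I \<Longrightarrow> has_inertia (V i) (B i) (p i)"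
    and q: "has_inertia U (\<lambda>x y. \<Sum>i\<in>I. if x \<in> V i \<and> y \<in> V i then B i x y else 0) q"
  shows "fst q \<le> fst (\<Sum>i\<in>I. p i)" "snd q \<le> snd (\<Sum>i\<in>I. p i)"
proof -
  obtain J :: "'a \<Rightarrow> nat set" and d z u where
    D: "\<And>i. i \<in> I \<Longrightarrow> diagonalizes (V i) (B i) (J i) (d i) (z i) (u i)"
    and p_eq: "\<And>i. i \<in> I \<Longrightarrow> p i = (\<Sum>j\<in>J i. sign_pair (d i j))"
    using has_inertia_family[of I V B p, OF p] by blast
  note D' = diagonalizesD[OF D]
  define z' where "z' k x = (if x \<in> V (fst k) then z (fst k) (snd k) x else 0)" for k x
  define d' where "d' k = d (fst k) (snd k)" for k
  have fin: "\<forall>i\<in>I. finite (J i)" using D'(1) by blast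
  have "(\<Sum>i\<in>I. if x \<in> V i \<and> y \<in> V i then B i x y else 0) =
      (\<Sum>k\<in>Sigma I J. of_real (d' k) * z' k x * cnj (z' k y))" for x y
  proof -
    have "(\<Sum>k\<in>Sigma I J. of_real (d' k) * z' k x * cnj (z' k y)) =
        (\<Sum>i\<in>I. \<Sum>j\<in>J i. of_real (d' (i, j)) * z' (i, j) x * cnj (z' (i, j) y))"
      by (subst sum.Sigma[OF I fin]) simp
    also have "\<dots> = (\<Sum>i\<in>I. if x \<in> V i \<and> y \<in> V i then B i x y else 0)"
      using D'(2) by (intro sum.cong refl) (auto simp: z'_def d'_def)
    finally show ?thesis by simp
  qed
  moreover have "(\<Sum>k\<in>Sigma I J. sign_pair (d' k)) = (\<Sum>i\<in>I. p i)"
    using sum.Sigma[OF I fin, of "\<lambda>i j. sign_pair (d i j)"] p_eq by (simp add: d'_def case_prod_beta)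
  ultimately show "fst q \<le> fst (\<Sum>i\<in>I. p i)" "snd q \<le> snd (\<Sum>i\<in>I. p i)"
    using sylvester_inertia[OF q, of "Sigma I J" d' z'] I fin by auto
qed

section \<open>The spectral theorem and eigenvalue counts\<close>

lemma cinner_scaled_sum:
  fixes w :: "nat \<Rightarrow> nat \<Rightarrow> complex"
  assumes "\<And>i. i < k \<Longrightarrow> i \<noteq> j \<Longrightarrow> (\<Sum>x\<in>S. cnj (w j x) * w i x) = 0" "j < k"
  shows "(\<Sum>x\<in>S. cnj (w j x) * (\<Sum>i<k. c i * w i x)) = c j * (\<Sum>x\<in>S. cnj (w j x) * w j x)"
proof -
  have "(\<Sum>x\<in>S. cnj (w j x) * (\<Sum>i<k. c i * w i x)) = (\<Sum>i<k. c i * (\<Sum>x\<in>S. cnj (w j x) * w i x))"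
    unfolding sum_distrib_left by (subst sum.swap) (simp add: mult_ac)
  also have "\<dots> = (\<Sum>i<k. if i = j then c j * (\<Sum>x\<in>S. cnj (w j x) * w j x) else 0)"
    using assms(1) by (intro sum.cong) auto
  finally show ?thesis using assms(2) by simp
qed

lemma cinner_self_nonzero:
  assumes "finite S" "x \<in> S" "w x \<noteq> 0"
  shows "(\<Sum>x\<in>S. cnj (w x) * w x) \<noteq> 0"
proof -
  have "(\<Sum>x\<in>S. (cmod (w x))\<^sup>2) > 0"
    using assms by (intro sum_pos2[of S x]) auto
  moreover have "(\<Sum>x\<in>S. cnj (w x) * w x) = of_real (\<Sum>x\<in>S. (cmod (w x))\<^sup>2)"
    unfolding of_real_sum complex_norm_square by (simp add: mult.commute)
  ultimately show ?thesis by (simp only: of_real_eq_0_iff)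
qed

text \<open>
  The Gram-Schmidt process applied to vectors \<open>p\<^sub>k\<close> that triangularize a Hermitian matrix. Subtracting
  from \<open>p\<^sub>k\<close> its projection onto the earlier \<open>w\<^sub>i\<close> gives a vector \<open>v\<close> for which \<open>a v - B\<^sub>k\<^sub>k v\<close> is a combination of
  the earlier \<open>w\<^sub>i\<close>. These are eigenvectors and orthogonal to \<open>v\<close>, hence, \<open>a\<close> being Hermitian, also
  orthogonal to \<open>a v\<close>; so the combination vanishes and \<open>v\<close> is an eigenvector. The functionals \<open>q\<close> dual
  to \<open>p\<close> show that \<open>v\<close> is nonzero: \<open>q\<^sub>k\<close> is \<open>1\<close> on \<open>p\<^sub>k\<close> and \<open>0\<close> on the earlier vectors.
\<close>

lemma orthogonal_eigenvectors_of_triangularization: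
  fixes a B p q :: "nat \<Rightarrow> nat \<Rightarrow> complex"
  assumes herm: "hermitian_on {..<n} a"
    and dual: "\<And>m i. m < n \<Longrightarrow> i < n \<Longrightarrow> (\<Sum>x<n. q m x * p i x) = of_bool (m = i)"
    and tri: "\<And>k x. k < n \<Longrightarrow> x < n \<Longrightarrow>
      (\<Sum>y<n. a x y * p k y) = (\<Sum>i<k. B i k * p i x) + B k k * p k x"
    and "k \<le> n"
  shows "\<exists>w.
     (\<forall>i<k. \<forall>j<k. i \<noteq> j \<longrightarrow> (\<Sum>x<n. cnj (w i x) * w j x) = 0) \<and>
     (\<forall>i<k. (\<Sum>x<n. cnj (w i x) * w i x) \<noteq> 0) \<and>
     (\<forall>i<k. \<forall>x<n. (\<Sum>y<n. a x y * w i y) = B i i * w i x) \<and>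
     (\<forall>i<k. \<exists>c. \<forall>x<n. p i x = (\<Sum>j<k. c j * w j x)) \<and>
     (\<forall>i<k. \<forall>m<n. k \<le> m \<longrightarrow> (\<Sum>x<n. q m x * w i x) = 0)"
  using \<open>k \<le> n\<close>
proof (induction k)
  case 0
  then show ?case by simp
next
  case (Suc k)
  then have k: "k < n" by simp
  from Suc obtain w where
    orth: "\<And>i j. i < k \<Longrightarrow> j < k \<Longrightarrow> i \<noteq> j \<Longrightarrow> (\<Sum>x<n. cnj (w i x) * w j x) = 0"
    and nz: "\<And>i. i < k \<Longrightarrow> (\<Sum>x<n. cnj (w i x) * w i x) \<noteq> 0"
    and eig: "\<And>i x. i < k \<Longrightarrow> x < n \<Longrightarrow> (\<Sum>y<n. a x y * w i y) = B i i * w i x"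
    and span: "\<forall>i\<in>{..<k}. \<exists>c. \<forall>x<n. p i x = (\<Sum>j<k. c j * w j x)"
    and ann: "\<And>i m. i < k \<Longrightarrow> m < n \<Longrightarrow> k \<le> m \<Longrightarrow> (\<Sum>x<n. q m x * w i x) = 0"
    by fastforce
  from bchoice[OF span] obtain c where c: "\<And>i x. i < k \<Longrightarrow> x < n \<Longrightarrow> p i x = (\<Sum>j<k. c i j * w j x)"
    by blast
  define \<alpha> where "\<alpha> j = (\<Sum>x<n. cnj (w j x) * p k x) / (\<Sum>x<n. cnj (w j x) * w j x)" for j
  define v where "v x = p k x - (\<Sum>j<k. \<alpha> j * w j x)" for x
  have wv: "(\<Sum>x<n. cnj (w j x) * v x) = 0" if j: "j < k" for j
    using cinner_scaled_sum[where S = "{..<n}" and w = w and c = \<alpha>, OF orth[OF j] j] nz[OF j]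
    by (simp add: v_def right_diff_distrib sum_subtractf \<alpha>_def)
  have vw: "(\<Sum>x<n. cnj (v x) * w j x) = 0" if j: "j < k" for j
  proof -
    have "(\<Sum>x<n. cnj (v x) * w j x) = cnj (\<Sum>x<n. cnj (w j x) * v x)" by (simp add: mult.commute)
    then show ?thesis using wv[OF j] by simp
  qed
  have qv: "(\<Sum>x<n. q m x * v x) = of_bool (m = k)" if m: "m < n" "k \<le> m" for m
  proof -
    have "(\<Sum>x<n. q m x * (\<Sum>j<k. \<alpha> j * w j x)) = (\<Sum>j<k. \<alpha> j * (\<Sum>x<n. q m x * w j x))"
      unfolding sum_distrib_left by (subst sum.swap) (simp add: mult_ac)
    also have "\<dots> = 0" using ann[OF _ m] by simp
    finally show ?thesis using dual[OF m(1) k] by (simp add: v_def right_diff_distrib sum_subtractf)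
  qed
  have v_nz: "(\<Sum>x<n. cnj (v x) * v x) \<noteq> 0"
  proof -
    have "\<exists>x<n. v x \<noteq> 0"
    proof (rule ccontr)
      assume "\<not> ?thesis"
      then have "(\<Sum>x<n. q k x * v x) = 0" by simp
      then show False using qv[OF k] by simp
    qed
    then show ?thesis using cinner_self_nonzero[of "{..<n}"] by blast
  qed
  define \<gamma> where "\<gamma> j = (\<Sum>i<k. B i k * c i j) + B k k * \<alpha> j - \<alpha> j * B j j" for j
  have residual: "(\<Sum>y<n. a x y * v y) - B k k * v x = (\<Sum>j<k. \<gamma> j * w j x)" if x: "x < n" for x
  proof -
    have "(\<Sum>y<n. a x y * (\<Sum>j<k. \<alpha> j * w j y)) = (\<Sum>j<k. \<alpha> j * (\<Sum>y<n. a x y * w j y))"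
      unfolding sum_distrib_left by (subst sum.swap) (simp add: mult_ac)
    also have "\<dots> = (\<Sum>j<k. \<alpha> j * B j j * w j x)" using eig x by (intro sum.cong) (auto simp: mult.assoc)
    finally have 1: "(\<Sum>y<n. a x y * v y) =
        (\<Sum>i<k. B i k * p i x) + B k k * p k x - (\<Sum>j<k. \<alpha> j * B j j * w j x)"
      using tri[OF k x] by (simp add: v_def right_diff_distrib sum_subtractf)
    have "(\<Sum>i<k. B i k * p i x) = (\<Sum>i<k. \<Sum>j<k. B i k * c i j * w j x)"
      using c x by (intro sum.cong refl) (auto simp: sum_distrib_left mult.assoc)
    also have "\<dots> = (\<Sum>j<k. (\<Sum>i<k. B i k * c i j) * w j x)"
      by (subst sum.swap) (simp add: sum_distrib_right)
    finally have 2: "(\<Sum>i<k. B i k * p i x) = (\<Sum>j<k. (\<Sum>i<k. B i k * c i j) * w j x)" .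
    show ?thesis unfolding 1 2 unfolding v_def \<gamma>_def
      by (simp add: algebra_simps sum_subtractf sum.distrib sum_distrib_left)
  qed
  have "\<gamma> j = 0" if j: "j < k" for j
  proof -
    have "\<gamma> j * (\<Sum>x<n. cnj (w j x) * w j x) = (\<Sum>x<n. cnj (w j x) * ((\<Sum>y<n. a x y * v y) - B k k * v x))"
      using cinner_scaled_sum[where S = "{..<n}" and w = w and c = \<gamma>, OF orth[OF j] j]
      by (simp add: residual)
    also have "\<dots> = (\<Sum>x<n. \<Sum>y<n. cnj (w j x) * a x y * v y) - B k k * (\<Sum>x<n. cnj (w j x) * v x)"
      by (simp add: right_diff_distrib sum_subtractf sum_distrib_left mult_ac)
    also have "(\<Sum>x<n. \<Sum>y<n. cnj (w j x) * a x y * v y) = (\<Sum>y<n. v y * cnj (\<Sum>x<n. a y x * w j x))"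
    proof -
      have "(\<Sum>x<n. \<Sum>y<n. cnj (w j x) * a x y * v y) = (\<Sum>y<n. \<Sum>x<n. v y * cnj (a y x * w j x))"
      proof (subst sum.swap, intro sum.cong refl)
        fix y x assume "y \<in> {..<n}" "x \<in> {..<n}"
        then have "a x y = cnj (a y x)" using hermitian_onD[OF herm] by blast
        then show "cnj (w j x) * a x y * v y = v y * cnj (a y x * w j x)" by (simp add: mult_ac)
      qed
      then show ?thesis by (simp add: sum_distrib_left)
    qed
    also have "\<dots> = cnj (B j j) * (\<Sum>x<n. cnj (w j x) * v x)"
      using eig[OF j] by (simp add: sum_distrib_left mult_ac)
    finally show ?thesis using wv[OF j] nz[OF j] by simp
  qed
  then have eig_v: "(\<Sum>y<n. a x y * v y) = B k k * v x" if "x < n" for x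
    using residual[OF that] by simp
  have span': "\<exists>c. \<forall>x<n. p i x = (\<Sum>j<Suc k. c j * (w(k := v)) j x)" if i: "i < Suc k" for i
  proof (cases "i = k")
    case True
    have "p k x = (\<Sum>j<Suc k. (\<alpha>(k := 1)) j * (w(k := v)) j x)" if "x < n" for x
      by (simp add: v_def)
    then show ?thesis using True by blast
  next
    case False
    then have "i < k" using i by simp
    then have "p i x = (\<Sum>j<Suc k. ((c i)(k := 0)) j * (w(k := v)) j x)" if "x < n" for x
      using c that by simp
    then show ?thesis by blast
  qed
  show ?case
    using orth nz eig wv vw v_nz eig_v span' ann qv
    by (intro exI[of _ "w(k := v)"] conjI allI impI) (auto simp: less_Suc_eq)
qed

lemma sign_pair_divide_pos: "r > 0 \<Longrightarrow> sign_pair (t / r) = sign_pair t"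
  by (simp add: sign_pair_def zero_less_divide_iff divide_less_0_iff)

text \<open>
  The spectral theorem in terms of inertia. A Schur decomposition supplies the triangularization;
  the conjugates of the resulting orthogonal eigenvectors \<open>w\<^sub>i\<close>, divided by their squared lengths \<open>r\<^sub>i\<close>,
  are dual to the \<open>w\<^sub>i\<close>, and the \<open>i\<close>-th coefficient is the \<open>i\<close>-th eigenvalue divided by \<open>r\<^sub>i\<close>.
\<close>

lemma hermitian_matrix_inertia:
  fixes A :: "complex mat"
  assumes A: "A \<in> carrier_mat n n" and herm: "hermitian_on {..<n} (\<lambda>x y. A $$ (x, y))"
    and es: "char_poly A = (\<Prod>e\<leftarrow>es. [:- e, 1:])" "length es = n"
  shows "has_inertia {..<n} (\<lambda>x y. A $$ (x, y)) (\<Sum>i<n. sign_pair (Re (es ! i)))"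
    and "\<forall>i<n. es ! i = of_real (Re (es ! i))"
proof -
  obtain B P Q where schur: "schur_decomposition A es = (B, P, Q)"
    by (cases "schur_decomposition A es") auto
  from schur_decomposition[OF A es(1) schur]
  have sim: "similar_mat_wit A B P Q" and ut: "upper_triangular B" and diag: "diag_mat B = es" by auto
  have BPQ: "B \<in> carrier_mat n n" "P \<in> carrier_mat n n" "Q \<in> carrier_mat n n"
    and QP: "Q * P = 1\<^sub>m n" and A_eq: "A = P * B * Q"
    using sim A by (auto simp: similar_mat_wit_def Let_def)
  have AP: "A * P = P * B"
  proof -
    have "A * P = P * B * (Q * P)" unfolding A_eq using BPQ by (simp add: assoc_mult_mat[of _ n n _ n _ n])
    then show ?thesis unfolding QP using BPQ by simp
  qed
  have entry: "(M * N) $$ (i, j) = (\<Sum>x<n. M $$ (i, x) * N $$ (x, j))"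
    if "M \<in> carrier_mat n n" "N \<in> carrier_mat n n" "i < n" "j < n" for M N :: "complex mat" and i j
    using that by (simp add: scalar_prod_def atLeast0LessThan)
  have Bes: "B $$ (i, i) = es ! i" if "i < n" for i
    using that BPQ(1) unfolding diag[symmetric] diag_mat_def by simp
  have dual: "(\<Sum>x<n. Q $$ (m, x) * P $$ (x, i)) = of_bool (m = i)" if "m < n" "i < n" for m i
    using entry[OF BPQ(3,2) that, symmetric] that unfolding QP by simp
  have tri: "(\<Sum>y<n. A $$ (x, y) * P $$ (y, k)) =
      (\<Sum>i<k. B $$ (i, k) * P $$ (x, i)) + B $$ (k, k) * P $$ (x, k)" if k: "k < n" and x: "x < n" for k x
  proof -
    have "(\<Sum>y<n. A $$ (x, y) * P $$ (y, k)) = (\<Sum>i<n. P $$ (x, i) * B $$ (i, k))"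
      using entry[OF A BPQ(2) x k] entry[OF BPQ(2,1) x k] AP by simp
    also have "\<dots> = (\<Sum>i<Suc k. P $$ (x, i) * B $$ (i, k))"
    proof (intro sum.mono_neutral_right ballI)
      fix i assume "i \<in> {..<n} - {..<Suc k}"
      then have "B $$ (i, k) = 0" using upper_triangularD[OF ut, of k i] BPQ(1) by auto
      then show "P $$ (x, i) * B $$ (i, k) = 0" by simp
    qed (use k in auto)
    finally show ?thesis by (simp add: mult.commute)
  qed
  obtain w where
    orth: "\<And>i j. i < n \<Longrightarrow> j < n \<Longrightarrow> i \<noteq> j \<Longrightarrow> (\<Sum>x<n. cnj (w i x) * w j x) = 0"
    and nz: "\<And>i. i < n \<Longrightarrow> (\<Sum>x<n. cnj (w i x) * w i x) \<noteq> 0"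
    and eig: "\<And>i x. i < n \<Longrightarrow> x < n \<Longrightarrow> (\<Sum>y<n. A $$ (x, y) * w i y) = es ! i * w i x"
    using orthogonal_eigenvectors_of_triangularization[OF herm dual tri order.refl] Bes by fastforce
  define r where "r i = (\<Sum>x<n. (cmod (w i x))\<^sup>2)" for i
  have r: "(\<Sum>x<n. cnj (w i x) * w i x) = of_real (r i)" for i
    unfolding r_def of_real_sum complex_norm_square by (simp add: mult.commute)
  have r_pos: "r i > 0" if "i < n" for i
  proof -
    have "r i \<ge> 0" unfolding r_def by (intro sum_nonneg) simp
    moreover have "r i \<noteq> 0" using nz[OF that] r[of i] by auto
    ultimately show ?thesis by simp
  qed
  have real: "es ! i = of_real (Re (es ! i))" if i: "i < n" for i
  proof -
    have "es ! i * of_real (r i) = (\<Sum>x<n. \<Sum>y<n. cnj (w i x) * (A $$ (x, y) * w i y))"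
      unfolding r[symmetric] sum_distrib_left[symmetric] using eig[OF i] by (simp add: sum_distrib_left mult_ac)
    also have "\<dots> = (\<Sum>y<n. \<Sum>x<n. cnj (w i x) * (A $$ (x, y) * w i y))" by (rule sum.swap)
    also have "\<dots> = (\<Sum>y<n. w i y * cnj (\<Sum>x<n. A $$ (y, x) * w i x))"
      unfolding cnj_sum sum_distrib_left
    proof (intro sum.cong refl)
      fix y x assume "y \<in> {..<n}" "x \<in> {..<n}"
      then have "A $$ (x, y) = cnj (A $$ (y, x))" using hermitian_onD[OF herm] by blast
      then show "cnj (w i x) * (A $$ (x, y) * w i y) = w i y * cnj (A $$ (y, x) * w i x)"
        by (simp add: mult_ac)
    qed
    also have "\<dots> = cnj (es ! i) * of_real (r i)"
      unfolding r[symmetric] using eig[OF i] by (simp add: sum_distrib_left mult_ac)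
    finally have "cnj (es ! i) = es ! i" using r_pos[OF i] by simp
    then show ?thesis by (metis Reals_cnj_iff of_real_Re)
  qed
  then show "\<forall>i<n. es ! i = of_real (Re (es ! i))" by blast
  define u where "u i x = cnj (w i x) / of_real (r i)" for i x
  have uw: "(\<Sum>x<n. u i x * w j x) = of_bool (i = j)" if "i < n" "j < n" for i j
  proof -
    have "(\<Sum>x<n. u i x * w j x) = (\<Sum>x<n. cnj (w i x) * w j x) / of_real (r i)"
      by (simp add: u_def sum_divide_distrib)
    then show ?thesis using orth[OF that] r[of i] r_pos[OF that(1)] by (cases "i = j") auto
  qed
  \<comment> \<open>Completeness of the eigenbasis: a left inverse of a square matrix is a right inverse.\<close>
  have wu: "(\<Sum>i<n. w i x * u i y) = of_bool (x = y)" if xy: "x < n" "y < n" for x y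
  proof -
    define U where "U = mat n n (\<lambda>(i, x). u i x)"
    define W where "W = mat n n (\<lambda>(x, i). w i x)"
    have UW: "U \<in> carrier_mat n n" "W \<in> carrier_mat n n" by (auto simp: U_def W_def)
    have "U * W = 1\<^sub>m n"
    proof (rule eq_matI)
      fix i j assume "i < dim_row (1\<^sub>m n :: complex mat)" "j < dim_col (1\<^sub>m n :: complex mat)"
      then have ij: "i < n" "j < n" by auto
      show "(U * W) $$ (i, j) = 1\<^sub>m n $$ (i, j)"
        unfolding entry[OF UW ij] using ij uw[OF ij] by (simp add: U_def W_def)
    qed (auto simp: U_def W_def)
    then have "W * U = 1\<^sub>m n" using mat_mult_left_right_inverse[OF UW] by simp
    then have "(\<Sum>i<n. W $$ (x, i) * U $$ (i, y)) = of_bool (x = y)"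
      unfolding entry[OF UW(2,1) xy, symmetric] using xy by simp
    then show ?thesis using xy by (simp add: U_def W_def)
  qed
  define d where "d i = Re (es ! i) / r i" for i
  have "diagonalizes {..<n} (\<lambda>x y. A $$ (x, y)) {..<n} d w u"
    unfolding diagonalizes_def
  proof (intro conjI ballI)
    fix x y assume "x \<in> {..<n}" "y \<in> {..<n}"
    then have xy: "x < n" "y < n" by auto
    have "A $$ (x, y) = (\<Sum>t<n. if t = y then A $$ (x, t) else 0)" using xy by simp
    also have "\<dots> = (\<Sum>t<n. \<Sum>i<n. A $$ (x, t) * (w i t * u i y))"
      unfolding sum_distrib_left[symmetric] using wu xy by (intro sum.cong) auto
    also have "\<dots> = (\<Sum>i<n. (\<Sum>t<n. A $$ (x, t) * w i t) * u i y)"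
      by (subst sum.swap) (simp add: sum_distrib_right mult.assoc)
    also have "\<dots> = (\<Sum>i<n. of_real (d i) * w i x * cnj (w i y))"
    proof (intro sum.cong refl)
      fix i assume "i \<in> {..<n}"
      then have i: "i < n" by simp
      show "(\<Sum>t<n. A $$ (x, t) * w i t) * u i y = of_real (d i) * w i x * cnj (w i y)"
        unfolding eig[OF i xy(1)] using real[OF i] by (simp add: u_def d_def)
    qed
    finally show "A $$ (x, y) = (\<Sum>i<n. of_real (d i) * w i x * cnj (w i y))" .
  qed (use uw in auto)
  from has_inertiaI[OF this refl]
  show "has_inertia {..<n} (\<lambda>x y. A $$ (x, y)) (\<Sum>i<n. sign_pair (Re (es ! i)))"
    using r_pos by (simp add: d_def sign_pair_divide_pos)
qed

text \<open>
  The order of a root of the characteristic polynomial is its number of occurrences in the list of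
  eigenvalues, so summing orders over eigenvalues counts list positions.
\<close>

lemma sum_order_real_eigenvalues:
  fixes A :: "complex mat"
  assumes A: "A \<in> carrier_mat n n"
    and es: "char_poly A = (\<Prod>e\<leftarrow>es. [:- e, 1:])" "length es = n"
    and real: "\<forall>i<n. es ! i = of_real (Re (es ! i))"
  shows "(\<Sum>x | R x \<and> eigenvalue A (of_real x). Polynomial.order (of_real x) (char_poly A)) =
    (\<Sum>i<n. of_bool (R (Re (es ! i))))"
proof -
  let ?S = "{x. R x \<and> eigenvalue A (of_real x)}"
  have eigenvalue: "eigenvalue A c \<longleftrightarrow> c \<in> set es" for c
    unfolding eigenvalue_root_char_poly[OF A] es(1) poly_prod_list prod_list_zero_iff by auto
  have fin: "finite ?S"
  proof (rule finite_subset)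
    show "?S \<subseteq> Re ` set es" using eigenvalue by (auto intro!: rev_image_eqI)
  qed simp
  have order: "Polynomial.order c (char_poly A) = (\<Sum>i<n. of_bool (es ! i = c))" for c
  proof -
    have "Polynomial.order c (char_poly A) = sum_list (map (\<lambda>e. of_bool (e = c)) es)"
      unfolding es(1) by (subst order_prod_list) (auto simp: o_def order_linear' of_bool_def
          intro!: arg_cong[of _ _ sum_list])
    then show ?thesis by (simp add: sum_list_sum_nth es(2) atLeast0LessThan)
  qed
  have "(\<Sum>x\<in>?S. Polynomial.order (of_real x) (char_poly A)) = (\<Sum>i<n. \<Sum>x\<in>?S. of_bool (es ! i = of_real x))"
    unfolding order by (rule sum.swap)
  also have "\<dots> = (\<Sum>i<n. of_bool (R (Re (es ! i))))"
  proof (intro sum.cong refl)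
    fix i assume "i \<in> {..<n}"
    then have i: "i < n" by simp
    have "(\<Sum>x\<in>?S. of_bool (es ! i = of_real x)) = (\<Sum>x\<in>?S. if x = Re (es ! i) then 1 else 0 :: nat)"
    proof (intro sum.cong refl)
      fix x :: real
      have "es ! i = of_real x \<longleftrightarrow> x = Re (es ! i)" using real i by (metis Re_complex_of_real)
      then show "of_bool (es ! i = of_real x) = (if x = Re (es ! i) then 1 else 0 :: nat)" by simp
    qed
    moreover have "eigenvalue A (of_real (Re (es ! i)))"
      unfolding eigenvalue using real i es(2) by (metis nth_mem)
    ultimately show "(\<Sum>x\<in>?S. of_bool (es ! i = of_real x)) = (of_bool (R (Re (es ! i))) :: nat)"
      using fin by simp
  qed
  finally show ?thesis .
qed

lemma has_inertia_pin:
  fixes A :: "complex mat"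
  assumes A: "A \<in> carrier_mat n n" and herm: "hermitian_on {..<n} (\<lambda>x y. A $$ (x, y))"
  shows "has_inertia {..<n} (\<lambda>x y. A $$ (x, y)) (pin A)"
proof -
  obtain es where es: "char_poly A = (\<Prod>e\<leftarrow>es. [:- e, 1:])" "length es = n"
    using char_poly_factorized[OF A] by blast
  note inertia = hermitian_matrix_inertia[OF A herm es]
  have "pin A = (\<Sum>i<n. sign_pair (Re (es ! i)))"
    unfolding pin_def num_pos_eigenvalues_def num_neg_eigenvalues_def
    by (simp add: sum_order_real_eigenvalues[OF A es inertia(2)] prod_eq_iff fst_sum snd_sum sign_pair_def)
  then show ?thesis using inertia(1) by simp
qed

text \<open>
  Complexification preserves the characteristic polynomial and the orders of real roots.
\<close>

lemma pin_map_complex_of_real: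
  fixes M :: "real mat"
  assumes M: "M \<in> carrier_mat n n"
  shows "pin (map_mat complex_of_real M) = pin M"
proof -
  interpret poly_hom: map_poly_inj_idom_divide_hom complex_of_real ..
  have cp: "char_poly (map_mat complex_of_real M) = map_poly complex_of_real (char_poly M)"
    by (rule of_real_hom.char_poly_hom[OF M])
  have eigenvalue: "eigenvalue (map_mat complex_of_real M) (of_real x) \<longleftrightarrow> eigenvalue M x" for x
  proof -
    have "map_mat complex_of_real M \<in> carrier_mat n n" using M by simp
    from eigenvalue_root_char_poly[OF this, of "of_real x"] eigenvalue_root_char_poly[OF M, of x]
    show ?thesis unfolding cp by simp
  qed
  show ?thesis
    unfolding pin_def num_pos_eigenvalues_def num_neg_eigenvalues_def cp eigenvalue
      poly_hom.order_hom by simp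
qed

section \<open>Inertia sets of patterns\<close>

lemma diagonalizes_transport:
  assumes f: "bij_betw f S V" and D: "diagonalizes V A J d z u"
  shows "diagonalizes S (\<lambda>x y. A (f x) (f y)) J d (\<lambda>j x. z j (f x)) (\<lambda>j x. u j (f x))"
  unfolding diagonalizes_def
proof (intro conjI ballI)
  note D = diagonalizesD[OF D]
  show "finite J" by (rule D(1))
  show "A (f x) (f y) = (\<Sum>j\<in>J. of_real (d j) * z j (f x) * cnj (z j (f y)))" if "x \<in> S" "y \<in> S" for x y
    using D(2)[of "f x" "f y"] that f by (auto simp: bij_betw_def)
  show "(\<Sum>x\<in>S. u i (f x) * z j (f x)) = of_bool (i = j)" if "i \<in> J" "j \<in> J" for i j
    using D(3)[OF that] sum.reindex_bij_betw[OF f, of "\<lambda>x. u i x * z j x"] by simp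
qed

lemma has_inertia_transport:
  assumes "bij_betw f S V" "has_inertia V A p"
  shows "has_inertia S (\<lambda>x y. A (f x) (f y)) p"
  using assms(2) diagonalizes_transport[OF assms(1)] unfolding has_inertia_def by blast

text \<open>
  The set \<open>K\<close> is \<open>\<real>\<close> for real symmetric and \<open>UNIV\<close> for complex Hermitian matrices.
\<close>

definition pattern_form :: "complex set \<Rightarrow> 'v set \<Rightarrow> ('v \<Rightarrow> 'v \<Rightarrow> bool) \<Rightarrow> ('v \<Rightarrow> 'v \<Rightarrow> complex) \<Rightarrow> bool" where
  "pattern_form K V E A \<longleftrightarrow> hermitian_on V A \<and>
     (\<forall>x\<in>V. \<forall>y\<in>V. A x y \<in> K \<and> (x \<noteq> y \<longrightarrow> (A x y \<noteq> 0 \<longleftrightarrow> E x y)))"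

definition form_inertia :: "complex set \<Rightarrow> 'v set \<Rightarrow> ('v \<Rightarrow> 'v \<Rightarrow> bool) \<Rightarrow> (nat \<times> nat) set" where
  "form_inertia K V E = {p. \<exists>A. pattern_form K V E A \<and> has_inertia V A p}"

lemma pattern_formD:
  assumes "pattern_form K V E A" "x \<in> V" "y \<in> V"
  shows "A y x = cnj (A x y)" "A x y \<in> K" "x \<noteq> y \<Longrightarrow> A x y \<noteq> 0 \<longleftrightarrow> E x y"
  using assms unfolding pattern_form_def hermitian_on_def by blast+

lemma pattern_form_cong:
  assumes "\<And>x y. x \<in> V \<Longrightarrow> y \<in> V \<Longrightarrow> x \<noteq> y \<Longrightarrow> E x y \<longleftrightarrow> F x y"
  shows "pattern_form K V E A \<longleftrightarrow> pattern_form K V F A"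
  using assms unfolding pattern_form_def by blast

lemma form_inertia_cong:
  assumes "\<And>x y. x \<in> V \<Longrightarrow> y \<in> V \<Longrightarrow> x \<noteq> y \<Longrightarrow> E x y \<longleftrightarrow> F x y"
  shows "form_inertia K V E = form_inertia K V F"
proof -
  have "pattern_form K V E A \<longleftrightarrow> pattern_form K V F A" for A
    by (rule pattern_form_cong) (rule assms)
  then show ?thesis by (simp add: form_inertia_def)
qed

lemma pattern_form_subset: "pattern_form K V E A \<Longrightarrow> W \<subseteq> V \<Longrightarrow> pattern_form K W E A"
  unfolding pattern_form_def using hermitian_on_subset by blast

lemma form_inertia_step:
  assumes K: "\<And>a r. a \<in> K \<Longrightarrow> a + complex_of_real r \<in> K" and V: "finite V"
    and p: "p \<in> form_inertia K V E" "fst p + snd p < card V"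
  shows "p + sign_pair t \<in> form_inertia K V E"
proof -
  obtain A where A: "pattern_form K V E A" "has_inertia V A p"
    using p(1) by (auto simp: form_inertia_def)
  obtain a where a: "a \<in> V" and inertia:
    "\<And>t. has_inertia V (\<lambda>x y. A x y + of_real t * of_bool (x = a) * of_bool (y = a)) (p + sign_pair t)"
    using perturb_diagonal_entry[OF V A(2) p(2)] by blast
  have "pattern_form K V E (\<lambda>x y. A x y + of_real t * of_bool (x = a) * of_bool (y = a))"
    unfolding pattern_form_def hermitian_on_def
  proof (intro conjI ballI)
    fix x y assume xy: "x \<in> V" "y \<in> V"
    have herm: "A y x = cnj (A x y)" and AK: "A x y \<in> K"
      and pat: "x \<noteq> y \<longrightarrow> (A x y \<noteq> 0 \<longleftrightarrow> E x y)"
      using pattern_formD[OF A(1) xy] by blast+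
    show "A y x + of_real t * of_bool (y = a) * of_bool (x = a) =
        cnj (A x y + of_real t * of_bool (x = a) * of_bool (y = a))"
      using herm by simp
    show "A x y + of_real t * of_bool (x = a) * of_bool (y = a) \<in> K"
      using AK K[OF AK, of t] by (cases "x = a"; cases "y = a") simp_all
    show "x \<noteq> y \<longrightarrow> (A x y + of_real t * of_bool (x = a) * of_bool (y = a) \<noteq> 0 \<longleftrightarrow> E x y)"
      using pat by auto
  qed
  then show ?thesis using inertia unfolding form_inertia_def by blast
qed

text \<open>
  As long as the form is singular, changing a diagonal entry moves its inertia one step in either
  direction, and the pattern does not constrain the diagonal.
\<close>

lemma form_inertia_northeast:
  assumes K: "\<And>a r. a \<in> K \<Longrightarrow> a + complex_of_real r \<in> K" and V: "finite V"
    and p: "p \<in> form_inertia K V E"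
    and le: "fst p \<le> fst q" "snd p \<le> snd q" "fst q + snd q \<le> card V"
  shows "q \<in> form_inertia K V E"
  using p le(1,2)
proof (induction "fst q + snd q - (fst p + snd p)" arbitrary: p rule: less_induct)
  case less
  show ?case
  proof (cases "p = q")
    case True
    then show ?thesis using less.prems by simp
  next
    case False
    define t :: real where "t = (if fst p < fst q then 1 else - 1)"
    have "fst p < fst q \<or> snd p < snd q" using False less.prems by (auto simp: prod_eq_iff)
    then have q: "fst (p + sign_pair t) \<le> fst q" "snd (p + sign_pair t) \<le> snd q"
      and smaller: "fst q + snd q - (fst (p + sign_pair t) + snd (p + sign_pair t)) <
        fst q + snd q - (fst p + snd p)"
      and "fst p + snd p < card V"
      using less.prems le(3) by (auto simp: t_def)
    from form_inertia_step[OF K V less.prems(1) this(4), of t]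
    show ?thesis using less.hyps[OF smaller] q by blast
  qed
qed

section \<open>Vertex sums\<close>

text \<open>
  The theorem for forms. The column of \<open>v\<close> is tested for membership in the range block by block, since
  the form on the union of the \<open>W i\<close> is a direct sum.
\<close>

theorem vertex_sum_form_inertia:
  fixes W :: "'i \<Rightarrow> 'v set"
  assumes K: "K = \<real> \<or> K = UNIV"
    and I: "finite I" "I \<noteq> {}"
    and W: "\<And>i. i \<in> I \<Longrightarrow> finite (W i)" "\<And>i. i \<in> I \<Longrightarrow> v \<notin> W i"
    and disj: "\<And>i j. i \<in> I \<Longrightarrow> j \<in> I \<Longrightarrow> i \<noteq> j \<Longrightarrow> W i \<inter> W j = {}"
    and sym: "\<And>x y. E x y \<Longrightarrow> E y x"
    and cross: "\<And>i j x y. i \<in> I \<Longrightarrow> j \<in> I \<Longrightarrow> i \<noteq> j \<Longrightarrow> x \<in> W i \<Longrightarrow> y \<in> W j \<Longrightarrow> \<not> E x y"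
    and V: "V = insert v (\<Union>i\<in>I. W i)"
  shows "form_inertia K V E =
    truncate_at (card V) (\<Sum>i\<in>I. form_inertia K (insert v (W i)) E) \<union>
    truncate_at (card V) ((\<Sum>i\<in>I. form_inertia K (W i) E) + {(1, 1)})"
proof -
  let ?W = "\<Union>i\<in>I. W i"
  have finW: "finite ?W" and vW: "v \<notin> ?W" using I W by auto
  have finV: "finite V" using finW V by simp
  have K_add: "a + complex_of_real r \<in> K" if "a \<in> K" for a r using K that by auto
  have K_real: "complex_of_real r \<in> K" for r using K by auto
  have K_sum: "(\<Sum>i\<in>I. g i) \<in> K" if "\<And>i. i \<in> I \<Longrightarrow> g i \<in> K" for g :: "'i \<Rightarrow> complex"
    using K that by (auto intro: sum_in_Reals)
  note northeast = form_inertia_northeast[OF K_add finV]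
  have block: "x \<in> W i \<longleftrightarrow> i = a" if "i \<in> I" "a \<in> I" "x \<in> W a" for i a x
    using disj[OF that(1,2)] that by blast
  have direct_sum: "has_inertia ?W A (\<Sum>i\<in>I. p i)"
    if A: "pattern_form K V E A" and p: "\<And>i. i \<in> I \<Longrightarrow> has_inertia (W i) A (p i)" for A p
  proof (rule direct_sum_inertia[OF I(1) W(1) disj p])
    fix i j x y assume ij: "i \<in> I" "j \<in> I" "i \<noteq> j" "x \<in> W i" "y \<in> W j"
    have "x \<in> V" "y \<in> V" "x \<noteq> y" using ij V disj[OF ij(1,2,3)] by blast+
    then show "A x y = 0" using pattern_formD(3)[OF A] cross[OF ij] by blast
  qed
  show ?thesis
  proof (intro equalityI subsetI)
    fix q assume "q \<in> form_inertia K V E"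
    then obtain A where A: "pattern_form K V E A" and q: "has_inertia V A q"
      by (auto simp: form_inertia_def)
    have herm: "hermitian_on (insert v ?W) A" using A V by (simp add: pattern_form_def)
    have q_le: "fst q + snd q \<le> card V" by (rule has_inertia_rank_le[OF q finV])
    have Wsub: "W i \<subseteq> V" if "i \<in> I" for i using that V by blast
    have patW: "pattern_form K (W i) E A" if "i \<in> I" for i
      using pattern_form_subset[OF A Wsub[OF that]] .
    have "\<forall>i\<in>I. \<exists>p. has_inertia (W i) A p"
      using patW W(1) has_inertia_exists unfolding pattern_form_def by blast
    from bchoice[OF this] obtain p where p: "\<And>i. i \<in> I \<Longrightarrow> has_inertia (W i) A (p i)" by blast
    note W_inertia = direct_sum[OF A p]
    have AW: "(\<Sum>y\<in>?W. A x y * h y) = (\<Sum>y\<in>W i. A x y * h y)" if i: "i \<in> I" and x: "x \<in> W i" for i x h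
    proof (rule sum.mono_neutral_right[OF finW])
      show "W i \<subseteq> ?W" using i by blast
      show "\<forall>y\<in>?W - W i. A x y * h y = 0"
      proof
        fix y assume y: "y \<in> ?W - W i"
        then obtain j where j: "j \<in> I" "y \<in> W j" "i \<noteq> j" by blast
        have "x \<in> V" "y \<in> V" "x \<noteq> y" using i x y V by blast+
        then show "A x y * h y = 0" using pattern_formD(3)[OF A, of x y] cross[OF i j(1,3) x j(2)] by simp
      qed
    qed
    show "q \<in> truncate_at (card V) (\<Sum>i\<in>I. form_inertia K (insert v (W i)) E) \<union>
      truncate_at (card V) ((\<Sum>i\<in>I. form_inertia K (W i) E) + {(1, 1)})"
    proof (cases "\<forall>i\<in>I. \<exists>h. \<forall>x\<in>W i. A x v = (\<Sum>y\<in>W i. A x y * h y)")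
      case True
      from bchoice[OF this] obtain h where
        h: "\<And>i x. i \<in> I \<Longrightarrow> x \<in> W i \<Longrightarrow> A x v = (\<Sum>y\<in>W i. A x y * h i y)" by blast
      define h' where "h' y = h (THE i. i \<in> I \<and> y \<in> W i) y" for y
      have h': "h' y = h i y" if "i \<in> I" "y \<in> W i" for i y
      proof -
        have "(THE i. i \<in> I \<and> y \<in> W i) = i" using that block by (intro the_equality) blast+
        then show ?thesis by (simp add: h'_def)
      qed
      have range: "A x v = (\<Sum>y\<in>?W. A x y * h' y)" if x: "x \<in> ?W" for x
      proof -
        obtain i where i: "i \<in> I" "x \<in> W i" using x by blast
        show ?thesis unfolding AW[OF i] h[OF i] using h'[OF i(1)] by simp
      qed
      define s where "s i = (\<Sum>x\<in>W i. cnj (h i x) * A x v)" for i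
      define t where "t = Re (A v v - (\<Sum>x\<in>?W. cnj (h' x) * A x v))"
      have "has_inertia V A ((\<Sum>i\<in>I. p i) + sign_pair t)"
        using border_inertia_in_range[OF finW vW herm W_inertia range] V by (simp add: t_def)
      then have q_eq: "q = (\<Sum>i\<in>I. p i) + sign_pair t" by (rule has_inertia_unique[OF q])
      \<comment> \<open>The diagonal entry at \<open>v\<close> is distributed so that block \<open>i0\<close> gets the Schur complement \<open>t\<close>, the others \<open>0\<close>.\<close>
      obtain i0 where i0: "i0 \<in> I" using I by blast
      define c where "c i = (if i = i0 then t else 0)" for i
      define B where "B i x y = (if x = v \<and> y = v then of_real (Re (s i) + c i) else A x y)" for i x y
      have "p i + sign_pair (c i) \<in> form_inertia K (insert v (W i)) E" if i: "i \<in> I" for i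
      proof -
        have sub: "insert v (W i) \<subseteq> V" using i V by blast
        have pat: "pattern_form K (insert v (W i)) E (B i)"
          unfolding pattern_form_def hermitian_on_def
        proof (intro conjI ballI)
          fix x y assume xy: "x \<in> insert v (W i)" "y \<in> insert v (W i)"
          have A_xy: "A y x = cnj (A x y)" "A x y \<in> K" "x \<noteq> y \<longrightarrow> (A x y \<noteq> 0 \<longleftrightarrow> E x y)"
            using pattern_formD[OF A, of x y] xy sub by blast+
          show "B i y x = cnj (B i x y)" using A_xy(1) by (simp add: B_def)
          show "B i x y \<in> K" using A_xy(2) K_real by (simp add: B_def del: of_real_add)
          show "x \<noteq> y \<longrightarrow> (B i x y \<noteq> 0 \<longleftrightarrow> E x y)" using A_xy(3) by (auto simp: B_def)
        qed
        have B_eq: "B i x y = A x y" if "x \<in> W i \<or> y \<in> W i" for x y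
          using that W(2)[OF i] by (auto simp: B_def)
        have "has_inertia (W i) (B i) (p i)"
          by (rule has_inertia_cong[OF p[OF i]]) (simp add: B_eq)
        moreover have "B i x v = (\<Sum>y\<in>W i. B i x y * h i y)" if "x \<in> W i" for x
          using h[OF i that] that by (simp add: B_eq)
        ultimately have "has_inertia (insert v (W i)) (B i)
            (p i + sign_pair (Re (B i v v - (\<Sum>x\<in>W i. cnj (h i x) * B i x v))))"
          using pat by (intro border_inertia_in_range[OF W(1,2)[OF i]]) (auto simp: pattern_form_def)
        moreover have "(\<Sum>x\<in>W i. cnj (h i x) * B i x v) = s i"
          by (simp add: s_def B_eq)
        moreover have "Re (B i v v - s i) = c i" by (simp add: B_def)
        ultimately have "has_inertia (insert v (W i)) (B i) (p i + sign_pair (c i))"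
          by (simp only:)
        then show ?thesis using pat unfolding form_inertia_def by blast
      qed
      moreover have "q = (\<Sum>i\<in>I. p i + sign_pair (c i))"
      proof -
        have "(\<Sum>i\<in>I. sign_pair (c i)) = (\<Sum>i\<in>I. if i = i0 then sign_pair t else 0)"
          by (intro sum.cong) (auto simp: c_def)
        then show ?thesis using I i0 by (simp add: q_eq sum.distrib)
      qed
      ultimately have "q \<in> (\<Sum>i\<in>I. form_inertia K (insert v (W i)) E)"
        unfolding set_sum_alt[OF I(1)] by blast
      then show ?thesis using q_le by (auto simp: truncate_at_def case_prod_beta)
    next
      case False
      then obtain i where i: "i \<in> I" and no: "\<not> (\<exists>h. \<forall>x\<in>W i. A x v = (\<Sum>y\<in>W i. A x y * h y))"
        by blast
      have "\<not> (\<exists>h. \<forall>x\<in>?W. A x v = (\<Sum>y\<in>?W. A x y * h y))"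
      proof
        assume "\<exists>h. \<forall>x\<in>?W. A x v = (\<Sum>y\<in>?W. A x y * h y)"
        then obtain h where h: "\<And>x. x \<in> ?W \<Longrightarrow> A x v = (\<Sum>y\<in>?W. A x y * h y)" by blast
        have "A x v = (\<Sum>y\<in>W i. A x y * h y)" if "x \<in> W i" for x
          using h[of x] AW[OF i that, of h] i that by auto
        then show False using no by blast
      qed
      from border_inertia_out_of_range[OF finW vW herm W_inertia this]
      have "q = (\<Sum>i\<in>I. p i) + (1, 1)" using has_inertia_unique[OF q] V by simp
      moreover have "(\<Sum>i\<in>I. p i) \<in> (\<Sum>i\<in>I. form_inertia K (W i) E)"
        unfolding set_sum_alt[OF I(1)] form_inertia_def using p patW by blast
      ultimately have "q \<in> (\<Sum>i\<in>I. form_inertia K (W i) E) + {(1, 1)}" by blast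
      then show ?thesis using q_le by (auto simp: truncate_at_def case_prod_beta)
    qed
  next
    fix q assume "q \<in> truncate_at (card V) (\<Sum>i\<in>I. form_inertia K (insert v (W i)) E) \<union>
      truncate_at (card V) ((\<Sum>i\<in>I. form_inertia K (W i) E) + {(1, 1)})"
    then consider
      (sum) "q \<in> (\<Sum>i\<in>I. form_inertia K (insert v (W i)) E)" "fst q + snd q \<le> card V" |
      (deleted) "q \<in> (\<Sum>i\<in>I. form_inertia K (W i) E) + {(1, 1)}" "fst q + snd q \<le> card V"
      by (auto simp: truncate_at_def case_prod_beta)
    then show "q \<in> form_inertia K V E"
    proof cases
      case sum
      then obtain p where q: "q = (\<Sum>i\<in>I. p i)"
        and p: "\<forall>i\<in>I. p i \<in> form_inertia K (insert v (W i)) E"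
        unfolding set_sum_alt[OF I(1)] by blast
      then have "\<forall>i\<in>I. \<exists>B. pattern_form K (insert v (W i)) E B \<and> has_inertia (insert v (W i)) B (p i)"
        by (simp add: form_inertia_def)
      from bchoice[OF this] obtain B where
        B: "\<And>i. i \<in> I \<Longrightarrow> pattern_form K (insert v (W i)) E (B i)"
        and p: "\<And>i. i \<in> I \<Longrightarrow> has_inertia (insert v (W i)) (B i) (p i)" by blast
      \<comment> \<open>The given forms overlap only in the entry at \<open>(v, v)\<close>, where their values are added.\<close>
      define A where "A x y =
        (\<Sum>i\<in>I. if x \<in> insert v (W i) \<and> y \<in> insert v (W i) then B i x y else 0)" for x y
      have A_pat: "pattern_form K V E A"
        unfolding pattern_form_def hermitian_on_def
      proof (intro conjI ballI impI)
        fix x y assume xy: "x \<in> V" "y \<in> V"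
        show "A y x = cnj (A x y)"
          unfolding A_def cnj_sum
        proof (intro sum.cong refl)
          fix i assume i: "i \<in> I"
          show "(if y \<in> insert v (W i) \<and> x \<in> insert v (W i) then B i y x else 0) =
              cnj (if x \<in> insert v (W i) \<and> y \<in> insert v (W i) then B i x y else 0)"
            using pattern_formD(1)[OF B[OF i], of x y]
            by (cases "x \<in> insert v (W i) \<and> y \<in> insert v (W i)") auto
        qed
        show "A x y \<in> K"
          unfolding A_def
        proof (rule K_sum)
          fix i assume "i \<in> I"
          then show "(if x \<in> insert v (W i) \<and> y \<in> insert v (W i) then B i x y else 0) \<in> K"
            using pattern_formD(2)[OF B[of i]] K_real[of 0] by auto
        qed
        assume neq: "x \<noteq> y"
        show "A x y \<noteq> 0 \<longleftrightarrow> E x y"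
        proof (cases "\<exists>i\<in>I. x \<in> insert v (W i) \<and> y \<in> insert v (W i)")
          case True
          then obtain i where i: "i \<in> I" "x \<in> insert v (W i)" "y \<in> insert v (W i)" by blast
          have "A x y = (\<Sum>j\<in>I. if j = i then B i x y else 0)"
            unfolding A_def
          proof (intro sum.cong refl)
            fix j assume j: "j \<in> I"
            show "(if x \<in> insert v (W j) \<and> y \<in> insert v (W j) then B j x y else 0) =
                (if j = i then B i x y else 0)"
              using i neq disj[OF j i(1)] by auto
          qed
          then have "A x y = B i x y" using I i by simp
          then show ?thesis using pattern_formD(3)[OF B[OF i(1)] i(2,3) neq] by simp
        next
          case False
          have "A x y = 0" unfolding A_def using False by (intro sum.neutral) auto
          moreover have "\<not> E x y"
          proof -
            have "x \<in> ?W" "y \<in> ?W" using xy[unfolded V] False neq by auto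
            then obtain i j where ij: "i \<in> I" "x \<in> W i" "j \<in> I" "y \<in> W j" by blast
            then have "i \<noteq> j" using False by blast
            then show ?thesis using cross ij by blast
          qed
          ultimately show ?thesis by simp
        qed
      qed
      have "hermitian_on V A" using A_pat by (simp add: pattern_form_def)
      then obtain r where r: "has_inertia V A r" using has_inertia_exists[OF finV] by blast
      have "r \<in> form_inertia K V E" using A_pat r unfolding form_inertia_def by blast
      moreover
      note inertia_subadditive[where V = "\<lambda>i. insert v (W i)" and B = B and p = p,
          OF I(1) p r[unfolded A_def[abs_def]]]
      then have "fst r \<le> fst q" "snd r \<le> snd q" unfolding q by simp_all
      ultimately show ?thesis using northeast sum(2) by blast
    next
      case deleted
      then obtain p where q: "q = (\<Sum>i\<in>I. p i) + (1, 1)"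
        and p: "\<forall>i\<in>I. p i \<in> form_inertia K (W i) E"
        unfolding set_sum_alt[OF I(1)] set_plus_def by blast
      then have "\<forall>i\<in>I. \<exists>B. pattern_form K (W i) E B \<and> has_inertia (W i) B (p i)"
        by (simp add: form_inertia_def)
      from bchoice[OF this] obtain B where
        B: "\<And>i. i \<in> I \<Longrightarrow> pattern_form K (W i) E (B i)"
        and p: "\<And>i. i \<in> I \<Longrightarrow> has_inertia (W i) (B i) (p i)" by blast
      \<comment> \<open>Any entries with the right pattern will do in the row and column of \<open>v\<close>; \<open>1\<close> is chosen on the edges.\<close>
      define A where "A x y = (if x = v \<or> y = v then of_bool (E x y) else
        \<Sum>i\<in>I. if x \<in> W i \<and> y \<in> W i then B i x y else 0)" for x y
      have A_block: "A x y = B i x y" if i: "i \<in> I" "x \<in> W i" "y \<in> W i" for i x y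
      proof -
        have "A x y = (\<Sum>j\<in>I. if j = i then B i x y else 0)"
        proof -
          have "x \<noteq> v" "y \<noteq> v" using i W(2) by blast+
          moreover have "x \<in> W j \<longleftrightarrow> j = i" "y \<in> W j \<longleftrightarrow> j = i" if "j \<in> I" for j
            using block[OF that i(1,2)] block[OF that i(1,3)] .
          ultimately show ?thesis unfolding A_def by (auto intro!: sum.cong)
        qed
        then show ?thesis using I i by simp
      qed
      have A_cross: "A x y = 0" if ij: "i \<in> I" "j \<in> I" "i \<noteq> j" "x \<in> W i" "y \<in> W j" for i j x y
      proof -
        have "x \<noteq> v" "y \<noteq> v" using ij W(2) by blast+
        moreover have "x \<in> W l \<longleftrightarrow> l = i" "y \<in> W l \<longleftrightarrow> l = j" if "l \<in> I" for l
          using block[OF that ij(1,4)] block[OF that ij(2,5)] .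
        ultimately show ?thesis unfolding A_def using ij(3) by (auto intro!: sum.neutral)
      qed
      have A_pat: "pattern_form K V E A"
        unfolding pattern_form_def hermitian_on_def
      proof -
        have "\<forall>x\<in>V. \<forall>y\<in>V. A y x = cnj (A x y) \<and> A x y \<in> K \<and> (x \<noteq> y \<longrightarrow> (A x y \<noteq> 0 \<longleftrightarrow> E x y))"
        proof (intro ballI)
          fix x y assume xy: "x \<in> V" "y \<in> V"
          consider (v) "x = v \<or> y = v" | (same) i where "i \<in> I" "x \<in> W i" "y \<in> W i"
            | (distinct) i j where "i \<in> I" "j \<in> I" "i \<noteq> j" "x \<in> W i" "y \<in> W j"
            using xy[unfolded V] by blast
          then show "A y x = cnj (A x y) \<and> A x y \<in> K \<and> (x \<noteq> y \<longrightarrow> (A x y \<noteq> 0 \<longleftrightarrow> E x y))"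
          proof cases
            case v
            have "E x y \<longleftrightarrow> E y x" using sym by blast
            then show ?thesis using v K_real[of 0] K_real[of 1] by (auto simp: A_def)
          next
            case same
            then have "B i y x = cnj (B i x y)" "B i x y \<in> K" "x \<noteq> y \<longrightarrow> (B i x y \<noteq> 0 \<longleftrightarrow> E x y)"
              using pattern_formD[OF B[OF same(1)] same(2,3)] by blast+
            then show ?thesis unfolding A_block[OF same] A_block[OF same(1,3,2)] by blast
          next
            case distinct
            have "A x y = 0" "A y x = 0" "\<not> E x y"
              using A_cross[OF distinct] A_cross[OF distinct(2,1) distinct(3)[symmetric] distinct(5,4)]
                cross[OF distinct] by blast+
            then show ?thesis using K_real[of 0] by simp
          qed
        qed
        then show "(\<forall>x\<in>V. \<forall>y\<in>V. A y x = cnj (A x y)) \<and>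
            (\<forall>x\<in>V. \<forall>y\<in>V. A x y \<in> K \<and> (x \<noteq> y \<longrightarrow> (A x y \<noteq> 0 \<longleftrightarrow> E x y)))" by blast
      qed
      have "has_inertia (W i) A (p i)" if "i \<in> I" for i
        by (rule has_inertia_cong[OF p[OF that]]) (simp add: A_block[OF that])
      note W_inertia = direct_sum[OF A_pat this]
      have herm: "hermitian_on (insert v ?W) A" using A_pat V by (simp add: pattern_form_def)
      obtain r where r: "has_inertia V A r" "fst r \<le> fst q" "snd r \<le> snd q"
        using border_inertia_le[OF finW vW herm W_inertia] V q by auto
      have "r \<in> form_inertia K V E" using A_pat r unfolding form_inertia_def by blast
      then show ?thesis using northeast r deleted(2) by blast
    qed
  qed
qed

section \<open>From forms to matrices of graphs\<close>

text \<open>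
  A form on \<open>V\<close> and an enumeration of \<open>V\<close> are the same as a matrix together with the vertices belonging
  to its rows; transport along the enumeration preserves the inertia, which for a matrix is
  \<^const>\<open>pin\<close>.
\<close>

lemma form_inertia_eq_pin:
  fixes V :: "'v set"
  assumes V: "finite V"
  shows "form_inertia K V E = pin ` {M \<in> carrier_mat (card V) (card V).
    hermitian_on {..<card V} (\<lambda>i j. M $$ (i, j)) \<and>
    (\<forall>i<card V. \<forall>j<card V. M $$ (i, j) \<in> K) \<and>
    (\<exists>f. bij_betw f {..<card V} V \<and> (\<forall>i<card V. \<forall>j<card V. i \<noteq> j \<longrightarrow> (M $$ (i, j) \<noteq> 0 \<longleftrightarrow> E (f i) (f j))))}"
    (is "_ = pin ` ?S")
proof (intro equalityI subsetI)
  fix p assume "p \<in> form_inertia K V E"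
  then obtain A where A: "pattern_form K V E A" "has_inertia V A p"
    by (auto simp: form_inertia_def)
  obtain f where f: "bij_betw f {..<card V} V"
    using ex_bij_betw_nat_finite[OF V] by (auto simp: atLeast0LessThan)
  have fV: "f i \<in> V" if "i < card V" for i using f that by (auto simp: bij_betw_def)
  have inj: "f i = f j \<longleftrightarrow> i = j" if "i < card V" "j < card V" for i j
    using f that by (auto simp: bij_betw_def inj_on_def)
  define M where "M = mat (card V) (card V) (\<lambda>(i, j). A (f i) (f j))"
  have M: "M \<in> carrier_mat (card V) (card V)" by (simp add: M_def)
  have M_entry: "M $$ (i, j) = A (f i) (f j)" if "i < card V" "j < card V" for i j
    using that by (simp add: M_def)
  have herm: "hermitian_on {..<card V} (\<lambda>i j. M $$ (i, j))"
    unfolding hermitian_on_def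
  proof (intro ballI)
    fix i j assume "i \<in> {..<card V}" "j \<in> {..<card V}"
    then have ij: "i < card V" "j < card V" by auto
    show "M $$ (j, i) = cnj (M $$ (i, j))"
      unfolding M_entry[OF ij] M_entry[OF ij(2,1)]
      by (rule pattern_formD(1)[OF A(1) fV[OF ij(1)] fV[OF ij(2)]])
  qed
  have "has_inertia {..<card V} (\<lambda>i j. M $$ (i, j)) p"
    by (rule has_inertia_cong[OF has_inertia_transport[OF f A(2)]]) (simp add: M_entry)
  then have "p = pin M" using has_inertia_unique has_inertia_pin[OF M herm] by blast
  moreover have "M \<in> ?S"
    using M herm f pattern_formD(2,3)[OF A(1)] fV inj by (auto simp: M_entry)
  ultimately show "p \<in> pin ` ?S" by blast
next
  fix p assume "p \<in> pin ` ?S"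
  then obtain M f where M: "M \<in> carrier_mat (card V) (card V)"
    and herm: "hermitian_on {..<card V} (\<lambda>i j. M $$ (i, j))"
    and MK: "\<And>i j. i < card V \<Longrightarrow> j < card V \<Longrightarrow> M $$ (i, j) \<in> K"
    and f: "bij_betw f {..<card V} V"
    and pat: "\<And>i j. i < card V \<Longrightarrow> j < card V \<Longrightarrow> i \<noteq> j \<Longrightarrow> (M $$ (i, j) \<noteq> 0 \<longleftrightarrow> E (f i) (f j))"
    and p: "p = pin M" by blast
  define g where "g = inv_into {..<card V} f"
  have g: "bij_betw g V {..<card V}" unfolding g_def by (rule bij_betw_inv_into[OF f])
  have gV: "g x < card V" "f (g x) = x" if "x \<in> V" for x
    using g f that by (auto simp: bij_betw_def g_def f_inv_into_f)
  have "pattern_form K V E (\<lambda>x y. M $$ (g x, g y))"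
    unfolding pattern_form_def hermitian_on_def
  proof (intro conjI ballI impI)
    fix x y assume xy: "x \<in> V" "y \<in> V"
    show "M $$ (g y, g x) = cnj (M $$ (g x, g y))"
      using hermitian_onD[OF herm, of "g x" "g y"] gV(1)[OF xy(1)] gV(1)[OF xy(2)] by simp
    show "M $$ (g x, g y) \<in> K" using MK gV xy by blast
    assume "x \<noteq> y"
    then have "g x \<noteq> g y" using gV(2) xy by metis
    then show "M $$ (g x, g y) \<noteq> 0 \<longleftrightarrow> E x y" using pat[of "g x" "g y"] gV xy by simp
  qed
  moreover have "has_inertia V (\<lambda>x y. M $$ (g x, g y)) p"
    using has_inertia_transport[OF g has_inertia_pin[OF M herm]] p by simp
  ultimately show "p \<in> form_inertia K V E" unfolding form_inertia_def by blast
qed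

lemma hermitian_inertia_set_eq:
  fixes G :: "('v, 'e) pre_digraph"
  assumes "finite (verts G)"
  shows "hermitian_inertia_set G = form_inertia UNIV (verts G) (\<lambda>x y. x \<rightarrow>\<^bsub>G\<^esub> y)"
proof -
  have "mat_adjoint M = M \<longleftrightarrow> hermitian_on {..<n} (\<lambda>i j. M $$ (i, j))"
    if M: "M \<in> carrier_mat n n" for M :: "complex mat" and n
  proof -
    have dim: "mat_adjoint M \<in> carrier_mat n n" using M unfolding mat_adjoint_def mat_of_rows_def by auto
    have "mat_adjoint M $$ (i, j) = cnj (M $$ (j, i))" if "i < n" "j < n" for i j
      using M that by (simp add: mat_adjoint_def mat_of_rows_def)
    then have "mat_adjoint M = M \<longleftrightarrow> (\<forall>i<n. \<forall>j<n. cnj (M $$ (j, i)) = M $$ (i, j))"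
      using M dim by (auto simp: mat_eq_iff)
    also have "\<dots> \<longleftrightarrow> hermitian_on {..<n} (\<lambda>i j. M $$ (i, j))"
      unfolding hermitian_on_def by (metis lessThan_iff)
    finally show ?thesis .
  qed
  then have "hermitian_mats G = {M \<in> carrier_mat (card (verts G)) (card (verts G)).
      hermitian_on {..<card (verts G)} (\<lambda>i j. M $$ (i, j)) \<and>
      (\<forall>i<card (verts G). \<forall>j<card (verts G). M $$ (i, j) \<in> UNIV) \<and>
      (\<exists>f. bij_betw f {..<card (verts G)} (verts G) \<and>
        (\<forall>i<card (verts G). \<forall>j<card (verts G). i \<noteq> j \<longrightarrow> (M $$ (i, j) \<noteq> 0 \<longleftrightarrow> f i \<rightarrow>\<^bsub>G\<^esub> f j)))}"
    unfolding hermitian_mats_def has_pattern_def by blast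
  then show ?thesis unfolding hermitian_inertia_set_def form_inertia_eq_pin[OF assms] by simp
qed

text \<open>
  Complexification identifies the real symmetric matrices with the Hermitian matrices with real entries.
\<close>

lemma inertia_set_eq:
  fixes G :: "('v, 'e) pre_digraph"
  assumes "finite (verts G)"
  shows "inertia_set G = form_inertia \<real> (verts G) (\<lambda>x y. x \<rightarrow>\<^bsub>G\<^esub> y)"
proof -
  let ?n = "card (verts G)"
  let ?S = "{M \<in> carrier_mat ?n ?n.
      hermitian_on {..<?n} (\<lambda>i j. M $$ (i, j)) \<and>
      (\<forall>i<?n. \<forall>j<?n. M $$ (i, j) \<in> \<real>) \<and>
      (\<exists>f. bij_betw f {..<?n} (verts G) \<and>
        (\<forall>i<?n. \<forall>j<?n. i \<noteq> j \<longrightarrow> (M $$ (i, j) \<noteq> 0 \<longleftrightarrow> f i \<rightarrow>\<^bsub>G\<^esub> f j)))}"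
  have "map_mat complex_of_real ` symmetric_mats G = ?S"
  proof (intro equalityI subsetI)
    fix M assume "M \<in> map_mat complex_of_real ` symmetric_mats G"
    then obtain N where N: "N \<in> symmetric_mats G" and M: "M = map_mat complex_of_real N" by blast
    have dim: "N \<in> carrier_mat ?n ?n" and tr: "transpose_mat N = N"
      using N by (auto simp: symmetric_mats_def has_pattern_def)
    have M_entry: "M $$ (i, j) = of_real (N $$ (i, j))" if "i < ?n" "j < ?n" for i j
      using that dim by (simp add: M)
    have "N $$ (j, i) = N $$ (i, j)" if "i < ?n" "j < ?n" for i j
      using that dim tr by (metis carrier_matD index_transpose_mat(1))
    then have "hermitian_on {..<?n} (\<lambda>i j. M $$ (i, j))" by (simp add: hermitian_on_def M_entry)
    moreover have "\<exists>f. bij_betw f {..<?n} (verts G) \<and>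
        (\<forall>i<?n. \<forall>j<?n. i \<noteq> j \<longrightarrow> (M $$ (i, j) \<noteq> 0 \<longleftrightarrow> f i \<rightarrow>\<^bsub>G\<^esub> f j))"
      using N by (simp add: symmetric_mats_def has_pattern_def M_entry)
    ultimately show "M \<in> ?S" using dim by (simp add: M_entry) (simp add: M)
  next
    fix M assume M: "M \<in> ?S"
    then have dim: "M \<in> carrier_mat ?n ?n"
      and herm: "hermitian_on {..<?n} (\<lambda>i j. M $$ (i, j))" by blast+
    define N where "N = map_mat Re M"
    have N_entry: "complex_of_real (N $$ (i, j)) = M $$ (i, j)" if "i < ?n" "j < ?n" for i j
      using that dim M by (simp add: N_def)
    have N_zero: "N $$ (i, j) \<noteq> 0 \<longleftrightarrow> M $$ (i, j) \<noteq> 0" if "i < ?n" "j < ?n" for i j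
      using N_entry[OF that, symmetric] by simp
    have N_dim: "N \<in> carrier_mat ?n ?n" using dim by (simp add: N_def)
    have "M = map_mat complex_of_real N"
      using dim N_dim by (intro eq_matI) (auto simp: N_entry)
    moreover have "transpose_mat N = N"
    proof (rule eq_matI)
      fix i j assume "i < dim_row N" "j < dim_col N"
      then have ij: "i < ?n" "j < ?n" using N_dim by auto
      have "complex_of_real (N $$ (j, i)) = cnj (complex_of_real (N $$ (i, j)))"
        unfolding N_entry[OF ij] N_entry[OF ij(2,1)]
        using hermitian_onD[OF herm, of i j] ij by simp
      then have "N $$ (j, i) = N $$ (i, j)" by simp
      then show "transpose_mat N $$ (i, j) = N $$ (i, j)" using ij N_dim by simp
    qed (use N_dim in auto)
    moreover have "has_pattern G N"
      unfolding has_pattern_def using M N_dim by (simp add: N_zero)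
    ultimately show "M \<in> map_mat complex_of_real ` symmetric_mats G"
      unfolding symmetric_mats_def by blast
  qed
  then have "form_inertia \<real> (verts G) (\<lambda>x y. x \<rightarrow>\<^bsub>G\<^esub> y) =
      pin ` map_mat complex_of_real ` symmetric_mats G"
    unfolding form_inertia_eq_pin[OF assms] by simp
  also have "\<dots> = pin ` symmetric_mats G"
    unfolding image_image
  proof (rule image_cong[OF refl])
    fix N assume "N \<in> symmetric_mats G"
    then have "N \<in> carrier_mat ?n ?n" by (auto simp: symmetric_mats_def has_pattern_def)
    then show "pin (map_mat complex_of_real N) = pin N" by (rule pin_map_complex_of_real)
  qed
  finally show ?thesis by (simp add: inertia_set_def)
qed

text \<open>
  The summands share only \<open>v\<close> and the edges of \<open>G\<close> are those of the summands. So adjacency in \<open>G\<close> restricts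
  to adjacency in each \<open>H i\<close>, and no edge joins vertices other than \<open>v\<close> of different summands.
\<close>

theorem theorem4p3:
  fixes G :: "('v, 'e) pre_digraph"
    and H :: "nat \<Rightarrow> ('v, 'e) pre_digraph"
    and v :: 'v
    and n k :: nat
  assumes "graph G"
    and "card (verts G) = n"
    and "n \<ge> 3"
    and "cut_vertex G v"
    and "k \<ge> 2"
    and "vertex_sum G v k H"
  shows "inertia_set G =
           truncate_at n (\<Sum>i=1..k. inertia_set (H i)) \<union>
           truncate_at n ((\<Sum>i=1..k. inertia_set (pre_digraph.del_vert (H i) v)) + {(1, 1)})
       \<and> hermitian_inertia_set G =
           truncate_at n (\<Sum>i=1..k. hermitian_inertia_set (H i)) \<union>
           truncate_at n ((\<Sum>i=1..k. hermitian_inertia_set (pre_digraph.del_vert (H i) v)) + {(1, 1)})"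
proof -
  let ?E = "\<lambda>x y. x \<rightarrow>\<^bsub>G\<^esub> y"
  define W where "W i = verts (H i) - {v}" for i
  interpret G: graph G by (rule assms(1))
  have graph: "graph (H i)" and ends: "tail G = tail (H i)" "head G = head (H i)"
    and vH: "v \<in> verts (H i)" if "i \<in> {1..k}" for i
    using assms(6) that unfolding vertex_sum_def compatible_def by blast+
  have disj: "verts (H i) \<inter> verts (H j) = {v}" if "i \<in> {1..k}" "j \<in> {1..k}" "i \<noteq> j" for i j
    using assms(6) that unfolding vertex_sum_def by blast
  have vertsG: "verts G = (\<Union>i\<in>{1..k}. verts (H i))" and arcsG: "arcs G = (\<Union>i\<in>{1..k}. arcs (H i))"
    using assms(6) unfolding vertex_sum_def by blast+
  have finH: "finite (verts (H i))" if "i \<in> {1..k}" for i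
    using graph[OF that] by (simp add: graph_def digraph_def fin_digraph.finite_verts)
  have endpoints: "x \<in> verts (H i) \<and> y \<in> verts (H i)" if "i \<in> {1..k}" "x \<rightarrow>\<^bsub>H i\<^esub> y" for i x y
  proof -
    interpret H: graph "H i" by (rule graph[OF that(1)])
    show ?thesis using that(2) H.adj_in_verts by blast
  qed
  have adj: "?E x y \<longleftrightarrow> (\<exists>i\<in>{1..k}. x \<rightarrow>\<^bsub>H i\<^esub> y)" for x y
    using ends unfolding arcs_ends_conv arcsG by fastforce
  have adjH: "?E x y \<longleftrightarrow> x \<rightarrow>\<^bsub>H i\<^esub> y"
    if i: "i \<in> {1..k}" and xy: "x \<in> verts (H i)" "y \<in> verts (H i)" "x \<noteq> y" for i x y
  proof
    assume "?E x y"
    then obtain j where j: "j \<in> {1..k}" "x \<rightarrow>\<^bsub>H j\<^esub> y" using adj by blast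
    have "i = j"
    proof (rule ccontr)
      assume "i \<noteq> j"
      then have "x \<in> {v}" "y \<in> {v}" using disj[OF i j(1)] endpoints[OF j] xy by blast+
      then show False using xy(3) by simp
    qed
    then show "x \<rightarrow>\<^bsub>H i\<^esub> y" using j by simp
  qed (use adj i in blast)
  have adj_del: "x \<rightarrow>\<^bsub>pre_digraph.del_vert (H i) v\<^esub> y \<longleftrightarrow> x \<rightarrow>\<^bsub>H i\<^esub> y"
    if "x \<noteq> v" "y \<noteq> v" for i x y
    using that unfolding arcs_ends_conv pre_digraph.del_vert_simps by auto
  have verts_del: "verts (pre_digraph.del_vert (H i) v) = W i" for i
    by (simp add: pre_digraph.del_vert_simps W_def)
  have insertW: "insert v (W i) = verts (H i)" if "i \<in> {1..k}" for i
    using vH[OF that] by (auto simp: W_def)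
  have "(1 :: nat) \<in> {1..k}" using assms(5) by simp
  then have V: "verts G = insert v (\<Union>i\<in>{1..k}. W i)" using vH unfolding vertsG W_def by blast
  have main: "form_inertia K (verts G) ?E =
      truncate_at n (\<Sum>i=1..k. form_inertia K (verts (H i)) (\<lambda>x y. x \<rightarrow>\<^bsub>H i\<^esub> y)) \<union>
      truncate_at n ((\<Sum>i=1..k. form_inertia K (W i) (\<lambda>x y. x \<rightarrow>\<^bsub>pre_digraph.del_vert (H i) v\<^esub> y)) + {(1, 1)})"
    if K: "K = \<real> \<or> K = UNIV" for K
  proof -
    have "form_inertia K (verts G) ?E =
      truncate_at (card (verts G)) (\<Sum>i=1..k. form_inertia K (insert v (W i)) ?E) \<union>
      truncate_at (card (verts G)) ((\<Sum>i=1..k. form_inertia K (W i) ?E) + {(1, 1)})"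
    proof (rule vertex_sum_form_inertia[OF K _ _ _ _ _ _ _ V])
      show "finite {1..k}" "{1..k} \<noteq> {}" using assms(5) by auto
      show "finite (W i)" "v \<notin> W i" if "i \<in> {1..k}" for i using finH[OF that] by (auto simp: W_def)
      show "W i \<inter> W j = {}" if "i \<in> {1..k}" "j \<in> {1..k}" "i \<noteq> j" for i j
        using disj[OF that] by (auto simp: W_def)
      show "?E y x" if "?E x y" for x y using that G.sym_arcs by (auto simp: symmetric_def elim: symE)
      show "\<not> ?E x y" if ij: "i \<in> {1..k}" "j \<in> {1..k}" "i \<noteq> j" and x: "x \<in> W i" and y: "y \<in> W j" for i j x y
      proof
        assume "?E x y"
        then obtain l where l: "l \<in> {1..k}" "x \<in> verts (H l)" "y \<in> verts (H l)"
          using adj endpoints by blast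
        have "l = i" using disj[OF l(1) ij(1)] l(2) x by (auto simp: W_def)
        moreover have "l = j" using disj[OF l(1) ij(2)] l(3) y by (auto simp: W_def)
        ultimately show False using ij(3) by simp
      qed
    qed
    moreover have "form_inertia K (insert v (W i)) ?E = form_inertia K (verts (H i)) (\<lambda>x y. x \<rightarrow>\<^bsub>H i\<^esub> y)"
      if "i \<in> {1..k}" for i
      unfolding insertW[OF that] using adjH[OF that] by (intro form_inertia_cong) blast
    moreover have "form_inertia K (W i) ?E =
        form_inertia K (W i) (\<lambda>x y. x \<rightarrow>\<^bsub>pre_digraph.del_vert (H i) v\<^esub> y)" if "i \<in> {1..k}" for i
      using adjH[OF that] adj_del by (intro form_inertia_cong) (auto simp: W_def)
    ultimately show ?thesis using assms(2) by simp
  qed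
  have finW: "finite (verts (pre_digraph.del_vert (H i) v))" if "i \<in> {1..k}" for i
    using finH[OF that] by (simp add: verts_del W_def)
  have "(\<Sum>i=1..k. inertia_set (H i)) = (\<Sum>i=1..k. form_inertia \<real> (verts (H i)) (\<lambda>x y. x \<rightarrow>\<^bsub>H i\<^esub> y))"
    "(\<Sum>i=1..k. inertia_set (pre_digraph.del_vert (H i) v)) =
      (\<Sum>i=1..k. form_inertia \<real> (W i) (\<lambda>x y. x \<rightarrow>\<^bsub>pre_digraph.del_vert (H i) v\<^esub> y))"
    "(\<Sum>i=1..k. hermitian_inertia_set (H i)) = (\<Sum>i=1..k. form_inertia UNIV (verts (H i)) (\<lambda>x y. x \<rightarrow>\<^bsub>H i\<^esub> y))"
    "(\<Sum>i=1..k. hermitian_inertia_set (pre_digraph.del_vert (H i) v)) =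
      (\<Sum>i=1..k. form_inertia UNIV (W i) (\<lambda>x y. x \<rightarrow>\<^bsub>pre_digraph.del_vert (H i) v\<^esub> y))"
    unfolding verts_del[symmetric]
    by (intro sum.cong refl inertia_set_eq hermitian_inertia_set_eq finH finW; assumption)+
  then show ?thesis
    using main[of \<real>] main[of UNIV]
    by (simp only: inertia_set_eq[OF G.finite_verts] hermitian_inertia_set_eq[OF G.finite_verts] simp_thms)
qed

end
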